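(* Let $\mathfrak{F}\subseteq\mathfrak{F}_{\mathrm{all}}$ satisfy $\mathfrak{F}\supseteq\mathfrak{F}_{\mathrm{AR}(2)}$ and suppose that the polynomial trend assumption holds: $X=(F,\tilde X)$, where $F$ is $n\times k_F$-dimensional ($1\le k_F\le k$) with $j$-th column $(1^{j-1},\ldots,n^{j-1})'$, where $\tilde X$ is an $n\times(k-k_F)$-dimensional matrix such that $X$ has rank $k$ ($\tilde X$ is the empty matrix if $k_F=k$), and the restriction matrix $R$ has a nonzero column $R_{\cdot i}$ for some $i\in\{1,\ldots,k_F\}$. Suppose further that the real $n\times n$ matrix $\mathcal{W}$ is constant (does not depend on $y\in\mathbb{R}^n$) and symmetric, and that $\Pi_{\mathrm{span}(X)^\perp}\mathcal{W}\Pi_{\mathrm{span}(X)^\perp}$ is nonzero and nonnegative definite. Let $\check\Omega_{\mathcal{W}}(y)=\hat\omega_{\mathcal{W}}(y)R(X'X)^{-1}R'$ with $\hat\omega_{\mathcal{W}}(y)=n^{-1}\hat u'(y)\mathcal{W}\hat u(y)$. Then $\check\beta=\hat\beta$ and $\check\Omega=\check\Omega_{\mathcal{W}}$ satisfy the estimator conditions with $N=\emptyset$. Let $T$ be the nonsphericity-corrected F-type test statistic with $\check\beta=\hat\beta$, $\check\Omega=\check\Omega_{\mathcal{W}}$, and $N=\emptyset$. Then $$\sup_{f\in\mathfrak{F}}P_{\mu_0,\sigma^2\Sigma(f)}(T\ge C)=1$$ holds for every critical value $C$, $-\infty<C<\infty$, for every $\mu_0\in\mathfrak{M}_0$, and for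 every $\sigma^2\in(0,\infty)$.
   Context: Model: $n,k,q$ are positive integers with $1\le k<n$; $X\in\mathbb{R}^{n\times k}$ is a fixed matrix of rank $k$; $R\in\mathbb{R}^{q\times k}$ has rank $q\ge 1$; $r\in\mathbb{R}^q$. (One tests $R\beta=r$ in $\mathbf{Y}=X\beta+\mathbf{U}$, $\mathbf{U}\sim N(0,\sigma^2\Sigma(f))$, $0<\sigma^2<\infty$, $f\in\mathfrak{F}$.) $'$ is transpose, $\mathrm{span}(\cdot)$ is column space, $\Pi_{\mathcal{L}}$ is orthogonal projection onto $\mathcal{L}$, $\mathfrak{M}_0=\{X\beta:R\beta=r\}$, $\hat\beta(y)=(X'X)^{-1}X'y$, $\hat u(y)=y-X\hat\beta(y)$. $P_{\mu,A}$ is the Gaussian measure on $\mathbb{R}^n$ with mean $\mu$ and covariance $A$; $P(T\ge C)$ means $P(\{y:T(y)\ge C\})$. $\lambda_{\mathbb{R}^n}$ is Lebesgue measure. Spectral densities: $\mathfrak{F}_{\mathrm{all}}$ is the set of all normalized spectral densities of real weakly stationary processes (nonnegative, even, integrable $f$ on $[-\pi,\pi]$ with $\int_{-\pi}^{\pi}f=1$); $\mathfrak{F}_{\mathrm{AR}(2)}$ is the subset of those corresponding to stationary autoregressive processes of order at most two; $\Sigma(f)=\left[\int_{-\pi}^{\pi}e^{-\iota(j-l)\omega}f(\omega)d\omega\right]_{j,l=1}^n$, $\iota$ the imaginary unit. Estimator conditions on $(\check\beta,\check\Omega,N)$: (i) $\check\beta:\mathbb{R}^n\setminus N\to\mathbb{R}^k$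 and $\check\Omega:\mathbb{R}^n\setminus N\to\mathbb{R}^{q\times q}$ are well-defined and continuous on $\mathbb{R}^n\setminus N$, where $N$ is a closed $\lambda_{\mathbb{R}^n}$-null set, and $\check\Omega(y)$ is symmetric for every $y\in\mathbb{R}^n\setminus N$; (ii) $y\in\mathbb{R}^n\setminus N$ implies $\delta y+X\eta\in\mathbb{R}^n\setminus N$ for all $\delta\ne0$, $\eta\in\mathbb{R}^k$; (iii) $\check\beta(\delta y+X\eta)=\delta\check\beta(y)+\eta$ and $\check\Omega(\delta y+X\eta)=\delta^2\check\Omega(y)$ for all $y\in\mathbb{R}^n\setminus N$, $\delta\neq0$, $\eta\in\mathbb{R}^k$; (iv) $\check\Omega$ is $\lambda_{\mathbb{R}^n}$-almost everywhere nonsingular on $\mathbb{R}^n\setminus N$. Nonsphericity-corrected F-type test statistic: with $N^*=N\cup\{y\in\mathbb{R}^n\setminus N:\det\check\Omega(y)=0\}$, $T(y)=(R\check\beta(y)-r)'\check\Omega^{-1}(y)(R\check\beta(y)-r)$ for $y\in\mathbb{R}^n\setminus N^*$ and $T(y)=0$ for $y\in N^*$. *)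

theory Defs
  imports "HOL-Probability.Probability"
begin

section \<open>Linear algebra\<close>

text \<open>
  Rows and columns of matrices are indexed by a finite linearly ordered type;
  \<open>pos i\<close> is the 1-based position of the index \<open>i\<close>, so \<open>pos\<close> is the increasing
  enumeration of the index type by \<open>{1..CARD('i)}\<close>.
\<close>

definition pos :: "'i::{finite,linorder} \<Rightarrow> nat" where
  "pos i = card {j. j \<le> i}"

definition colspan :: "real^'k^'n \<Rightarrow> (real^'n) set" where
  "colspan A = span (columns A)"

definition projection_matrix :: "(real^'n) set \<Rightarrow> real^'n^'n" where
  "projection_matrix L =
     matrix (\<lambda>y. THE z. z \<in> L \<and> (\<forall>w\<in>L. orthogonal (y - z) w))"

definition symmetric_matrix :: "real^'n^'n \<Rightarrow> bool" where
  "symmetric_matrix A \<longleftrightarrow> transpose A = A"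

definition nonneg_definite :: "real^'n^'n \<Rightarrow> bool" where
  "nonneg_definite A \<longleftrightarrow> symmetric_matrix A \<and> (\<forall>x. 0 \<le> x \<bullet> (A *v x))"


section \<open>Gaussian measures\<close>

definition std_gaussian :: "(real^'n) measure" where
  "std_gaussian = density lborel (\<lambda>z. ennreal (\<Prod>i\<in>UNIV. std_normal_density (z $ i)))"

text \<open>
  The law of \<open>\<mu> + B Z\<close> with \<open>Z\<close> standard normal and \<open>B B' = A\<close>. Such a \<open>B\<close> exists for
  every symmetric nonnegative definite \<open>A\<close> (singular \<open>A\<close> included), and the law does not
  depend on its choice, since two square factors of \<open>A\<close> differ by an orthogonal matrix
  acting on \<open>Z\<close>. The value for other \<open>A\<close> has no meaning.
\<close>

definition gaussian :: "real^'n \<Rightarrow> real^'n^'n \<Rightarrow> (real^'n) measure" where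
  "gaussian \<mu> A =
     distr std_gaussian borel
       (\<lambda>z. \<mu> + (SOME B :: real^'n^'n. B ** transpose B = A) *v z)"


section \<open>Spectral densities\<close>

text \<open>
  A function on \<open>[-\<pi>, \<pi>]\<close> is an element of \<open>extensional {-pi..pi}\<close>, so that it is
  determined by its values on the interval.
\<close>

definition F_all :: "(real \<Rightarrow> real) set" where
  "F_all = {f \<in> extensional {-pi..pi}.
     (\<forall>\<omega>\<in>{-pi..pi}. 0 \<le> f \<omega> \<and> f (-\<omega>) = f \<omega>) \<and>
     f absolutely_integrable_on {-pi..pi} \<and>
     integral {-pi..pi} f = 1}"

definition covariance :: "'a measure \<Rightarrow> ('a \<Rightarrow> real) \<Rightarrow> ('a \<Rightarrow> real) \<Rightarrow> real" where
  "covariance M U V =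
     (\<integral>\<omega>. (U \<omega> - (\<integral>\<omega>'. U \<omega>' \<partial>M)) * (V \<omega> - (\<integral>\<omega>'. V \<omega>' \<partial>M)) \<partial>M)"

definition weakly_stationary :: "'a measure \<Rightarrow> (int \<Rightarrow> 'a \<Rightarrow> real) \<Rightarrow> bool" where
  "weakly_stationary M Y \<longleftrightarrow>
     prob_space M \<and>
     (\<forall>t. Y t \<in> borel_measurable M \<and> integrable M (\<lambda>\<omega>. (Y t \<omega>)\<^sup>2)) \<and>
     (\<forall>s t. (\<integral>\<omega>. Y s \<omega> \<partial>M) = (\<integral>\<omega>. Y t \<omega> \<partial>M)) \<and>
     (\<forall>s t h. covariance M (Y (s + h)) (Y (t + h)) = covariance M (Y s) (Y t))"

definition white_noise :: "'a measure \<Rightarrow> (int \<Rightarrow> 'a \<Rightarrow> real) \<Rightarrow> bool" where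
  "white_noise M \<epsilon> \<longleftrightarrow>
     weakly_stationary M \<epsilon> \<and>
     (\<forall>t. (\<integral>\<omega>. \<epsilon> t \<omega> \<partial>M) = 0) \<and>
     (\<forall>s t. s \<noteq> t \<longrightarrow> covariance M (\<epsilon> s) (\<epsilon> t) = 0) \<and>
     0 < covariance M (\<epsilon> 0) (\<epsilon> 0)"

text \<open>Order at most two: either coefficient may vanish.\<close>

definition stationary_AR2 :: "'a measure \<Rightarrow> (int \<Rightarrow> 'a \<Rightarrow> real) \<Rightarrow> bool" where
  "stationary_AR2 M Y \<longleftrightarrow>
     weakly_stationary M Y \<and>
     (\<exists>a1 a2 \<epsilon>. white_noise M \<epsilon> \<and>
        (\<forall>t. AE \<omega> in M. Y t \<omega> = a1 * Y (t - 1) \<omega> + a2 * Y (t - 2) \<omega> + \<epsilon> t \<omega>))"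

text \<open>
  Normalized: \<open>f\<close> is the spectral density of the autocorrelation function.
\<close>

definition normalized_spectral_density ::
    "'a measure \<Rightarrow> (int \<Rightarrow> 'a \<Rightarrow> real) \<Rightarrow> (real \<Rightarrow> real) \<Rightarrow> bool" where
  "normalized_spectral_density M Y f \<longleftrightarrow>
     (\<forall>h. complex_of_real (covariance M (Y h) (Y 0)) =
        complex_of_real (covariance M (Y 0) (Y 0)) *
        integral {-pi..pi} (\<lambda>\<omega>. exp (\<i> * of_int h * of_real \<omega>) * of_real (f \<omega>)))"

text \<open>
  The law of a real process indexed by the integers lives on the path space
  \<open>int \<Rightarrow> real\<close>, so it suffices to let the probability measures range over that type.
  A spectral density is only determined almost everywhere; that of an autoregressive
  process has exactly one continuous version, which is the one in \<open>F_AR2\<close>. Admitting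
  the other versions would only make the requirement \<open>F_AR2 \<subseteq> F\<close> more restrictive.
\<close>

definition F_AR2 :: "(real \<Rightarrow> real) set" where
  "F_AR2 = {f \<in> F_all. continuous_on {-pi..pi} f \<and>
     (\<exists>(M :: (int \<Rightarrow> real) measure) Y.
        stationary_AR2 M Y \<and> normalized_spectral_density M Y f)}"

text \<open>The entries below are real because \<open>f\<close> is even, so taking \<open>Re\<close> loses nothing.\<close>

definition Sigma_f :: "(real \<Rightarrow> real) \<Rightarrow> real^('n::{finite,linorder})^('n::{finite,linorder})" where
  "Sigma_f f = (\<chi> j l.
     Re (integral {-pi..pi}
       (\<lambda>\<omega>. exp (- \<i> * of_int (int (pos j) - int (pos l)) * of_real \<omega>) * of_real (f \<omega>))))"


section \<open>Estimators and the test statistic\<close>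

definition null_hypothesis :: "real^'k^'n \<Rightarrow> real^'k^'q \<Rightarrow> real^'q \<Rightarrow> (real^'n) set" where
  "null_hypothesis X R r = {X *v \<beta> |\<beta>. R *v \<beta> = r}"

definition ols :: "real^'k^'n \<Rightarrow> real^'n \<Rightarrow> real^'k" where
  "ols X y = matrix_inv (transpose X ** X) *v (transpose X *v y)"

definition residual :: "real^'k^'n \<Rightarrow> real^'n \<Rightarrow> real^'n" where
  "residual X y = y - X *v ols X y"

text \<open>
  Estimators are total functions of which only the values outside \<open>N\<close> matter.
\<close>

definition estimator_conditions ::
    "real^'k^'n \<Rightarrow> (real^'n \<Rightarrow> real^'k) \<Rightarrow> (real^'n \<Rightarrow> real^'q^'q) \<Rightarrow> (real^'n) set \<Rightarrow> bool" where
  "estimator_conditions X \<beta> \<Omega> N \<longleftrightarrow>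
     closed N \<and> N \<in> null_sets lborel \<and>
     continuous_on (- N) \<beta> \<and> continuous_on (- N) \<Omega> \<and>
     (\<forall>y. y \<notin> N \<longrightarrow> symmetric_matrix (\<Omega> y)) \<and>
     (\<forall>y \<delta> \<eta>. y \<notin> N \<longrightarrow> \<delta> \<noteq> 0 \<longrightarrow> \<delta> *\<^sub>R y + X *v \<eta> \<notin> N) \<and>
     (\<forall>y \<delta> \<eta>. y \<notin> N \<longrightarrow> \<delta> \<noteq> 0 \<longrightarrow>
        \<beta> (\<delta> *\<^sub>R y + X *v \<eta>) = \<delta> *\<^sub>R \<beta> y + \<eta> \<and>
        \<Omega> (\<delta> *\<^sub>R y + X *v \<eta>) = \<delta>\<^sup>2 *\<^sub>R \<Omega> y) \<and>
     (AE y in lborel. y \<notin> N \<longrightarrow> invertible (\<Omega> y))"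

definition F_type_statistic ::
    "real^'k^'q \<Rightarrow> real^'q \<Rightarrow> (real^'n \<Rightarrow> real^'k) \<Rightarrow> (real^'n \<Rightarrow> real^'q^'q) \<Rightarrow> (real^'n) set
      \<Rightarrow> real^'n \<Rightarrow> real" where
  "F_type_statistic R r \<beta> \<Omega> N y =
     (if y \<in> N \<union> {y. y \<notin> N \<and> det (\<Omega> y) = 0} then 0
      else (R *v \<beta> y - r) \<bullet> (matrix_inv (\<Omega> y) *v (R *v \<beta> y - r)))"

definition omega_W :: "real^'n^'n \<Rightarrow> real^'k^'n \<Rightarrow> real^'n \<Rightarrow> real" where
  "omega_W W X y = (residual X y \<bullet> (W *v residual X y)) / real CARD('n)"

definition Omega_W :: "real^'n^'n \<Rightarrow> real^'k^'n \<Rightarrow> real^'k^'q \<Rightarrow> real^'n \<Rightarrow> real^'q^'q" where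
  "Omega_W W X R y =
     omega_W W X y *\<^sub>R (R ** matrix_inv (transpose X ** X) ** transpose R)"

text \<open>
  The first \<open>kF\<close> columns of \<open>X\<close> are the monomials \<open>t^(j-1)\<close>, \<open>t = 1,...,n\<close>; the remaining
  columns are unrestricted (the rank of \<open>X\<close> is assumed separately).
\<close>

definition polynomial_trend ::
    "nat \<Rightarrow> real^('k::{finite,linorder})^('n::{finite,linorder}) \<Rightarrow> real^('k::{finite,linorder})^'q \<Rightarrow> bool" where
  "polynomial_trend kF X R \<longleftrightarrow>
     1 \<le> kF \<and> kF \<le> CARD('k) \<and>
     (\<forall>t j. pos j \<le> kF \<longrightarrow> X $ t $ j = real (pos t) ^ (pos j - 1)) \<and>
     (\<exists>i. pos i \<le> kF \<and> column i R \<noteq> 0)"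

end

theory Submission
  imports Defs "HOL-Real_Asymp.Real_Asymp"
begin

text \<open>
  Write \<open>u = y - \<mu>\<^sub>0\<close>, \<open>H = R (X' X)\<^sup>-\<^sup>1 X'\<close> and \<open>P\<close> for the projection onto the orthogonal complement
  of \<open>span X\<close>. Then \<open>T\<close> is the quotient of a positive definite form in \<open>H u\<close> and a nonnegative
  form in \<open>P u\<close>, so it suffices that under suitable \<open>f \<in> F\<close> the vector \<open>H u\<close> dominates \<open>P u\<close>.

  The quadratic form of \<open>Sigma_f f\<close> is \<open>v' \<Sigma>(f) v = \<integral> |\<Sum>\<^sub>t v\<^sub>t exp (\<i> t \<omega>)|\<^sup>2 f(\<omega>) d\<omega>\<close>. Rows of \<open>P\<close> annihilate
  all polynomial trends of degree less than \<open>k\<^sub>F\<close>, so for them the integrand is \<open>O(\<omega>\<^bsup>2 k\<^sub>F\<^esup>)\<close>, whereas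
  some row of \<open>H\<close> does not annihilate the trend of some degree \<open>d < k\<^sub>F\<close>, so that the integrand there
  has exact order \<open>\<omega>\<^bsup>2 d\<^esup>\<close>. AR(2) densities with roots close to \<open>exp (\<plusminus> \<i> \<gamma>)\<close> concentrate at \<open>\<plusminus> \<gamma>\<close>, and
  letting \<open>\<gamma> \<rightarrow> 0\<close> makes \<open>H u\<close> dominate. A compactness argument for the normalized factors
  \<open>H B / \<parallel>H B\<parallel>\<close> with \<open>B B' = \<Sigma>(f)\<close> turns this into almost sure divergence of \<open>T\<close> along a
  subsequence.
\<close>

section \<open>Linear algebra\<close>

lemma pos_strict_mono: "i < j \<Longrightarrow> pos i < pos j"
  unfolding pos_def by (rule psubset_card_mono) (auto simp: psubset_eq dest: leD)

lemma pos_inject: "pos i = pos j \<longleftrightarrow> i = j"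
  by (metis linorder_neqE nat_neq_iff pos_strict_mono)

lemma pos_range: "range (pos :: 'i::{finite,linorder} \<Rightarrow> nat) = {1..CARD('i)}"
proof (rule card_subset_eq)
  show "range (pos :: 'i \<Rightarrow> nat) \<subseteq> {1..CARD('i)}"
    unfolding pos_def by (auto simp: Suc_le_eq card_gt_0_iff intro!: card_mono)
  show "card (range (pos :: 'i \<Rightarrow> nat)) = card {1..CARD('i)}"
    by (simp add: card_image inj_def pos_inject)
qed simp

section \<open>Matrix inverses and definite forms\<close>

lemma inner_matrix_transpose: "x \<bullet> (A *v y) = (transpose A *v x) \<bullet> (y :: real^'n)"
  by (simp add: dot_lmul_matrix)

lemma
  assumes "invertible (A :: real^'n^'n)"
  shows matrix_inv_right: "A ** matrix_inv A = mat 1" and matrix_inv_left: "matrix_inv A ** A = mat 1"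
  using assms someI_ex[of "\<lambda>B. A ** B = mat 1 \<and> B ** A = mat 1"]
  unfolding invertible_def matrix_inv_def by auto

text \<open>\<open>matrix_inv\<close> is a choice, but a one-sided inverse of a square matrix is
  two-sided, hence the only candidate.\<close>

lemma matrix_inv_eqI:
  assumes "A ** B = mat 1" shows "matrix_inv (A :: real^'n^'n) = B"
proof -
  have "invertible A"
    using assms invertible_right_inverse by blast
  then show ?thesis
    by (metis assms matrix_inv_left matrix_mul_assoc matrix_mul_lid matrix_mul_rid)
qed

lemma scaleR_matrix_inv:
  assumes "invertible (A :: real^'n^'n)" "c \<noteq> 0"
  shows "invertible (c *\<^sub>R A)" "matrix_inv (c *\<^sub>R A) = (1/c) *\<^sub>R matrix_inv A"
proof -
  have *: "(c *\<^sub>R A) ** ((1/c) *\<^sub>R matrix_inv A) = mat 1"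
    using assms by (simp add: matrix_scalar_ac matrix_inv_right flip: scalar_matrix_assoc)
  show "matrix_inv (c *\<^sub>R A) = (1/c) *\<^sub>R matrix_inv A"
    using * by (rule matrix_inv_eqI)
  show "invertible (c *\<^sub>R A)"
    using * invertible_right_inverse by blast
qed

lemma pos_def_invertible:
  assumes "\<And>x. x \<noteq> 0 \<Longrightarrow> 0 < x \<bullet> ((A :: real^'n^'n) *v x)"
  shows "invertible A"
proof -
  have "x = 0" if "A *v x = 0" for x
    using assms[of x] that by fastforce
  then show ?thesis
    by (metis invertible_left_inverse matrix_left_invertible_ker)
qed

lemma pos_def_matrix_inv:
  assumes pd: "\<And>x. x \<noteq> 0 \<Longrightarrow> 0 < x \<bullet> ((A :: real^'n^'n) *v x)" and "x \<noteq> 0"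
  shows "0 < x \<bullet> (matrix_inv A *v x)"
proof -
  have inv: "invertible A" using pd by (rule pos_def_invertible)
  let ?y = "matrix_inv A *v x"
  have y: "A *v ?y = x"
    using inv by (simp add: matrix_vector_mul_assoc matrix_inv_right)
  with \<open>x \<noteq> 0\<close> have "?y \<noteq> 0" by auto
  with pd[of ?y] y show ?thesis by (simp add: inner_commute)
qed

lemma symmetric_matrix_inv:
  assumes "symmetric_matrix A" "invertible (A :: real^'n^'n)"
  shows "symmetric_matrix (matrix_inv A)"
proof -
  have "transpose (matrix_inv A ** A) = mat 1"
    using assms by (simp add: matrix_inv_left transpose_mat)
  then have "A ** transpose (matrix_inv A) = mat 1"
    using assms by (simp add: matrix_transpose_mul symmetric_matrix_def)
  then show ?thesis
    unfolding symmetric_matrix_def using matrix_inv_eqI by metis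
qed

text \<open>A quadratic that is nonnegative on the whole line has no positive discriminant. The
  degenerate leading coefficient is included because semidefinite forms produce it.\<close>

lemma discriminant_le:
  fixes p q w :: real
  assumes "\<And>t. 0 \<le> p - 2 * t * q + t\<^sup>2 * w"
  shows "q\<^sup>2 \<le> p * w"
proof (cases "w = 0")
  case True
  \<comment> \<open>The quadratic is now affine; for \<open>q\<close> nonzero the chosen point gives
    the value -1.\<close>
  then show ?thesis
    using assms[of "(p + 1) / (2 * q)"] by (cases "q = 0") auto
next
  case False
  have "0 \<le> w"
  proof (rule ccontr)
    assume "\<not> 0 \<le> w"
    \<comment> \<open>Averaging over \<open>t\<close> and \<open>-t\<close> removes the linear term.
      With \<open>t\<^sup>2 = s\<close> the rest is \<open>p - \<bar>p\<bar> - 1\<close>, which is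
      negative.\<close>
    moreover have "0 \<le> p + t\<^sup>2 * w" for t
      using assms[of t] assms[of "-t"] by simp
    moreover define s where "s = (\<bar>p\<bar> + 1) / (- w)"
    ultimately have "0 \<le> p + (sqrt s)\<^sup>2 * w" by blast
    moreover have "0 \<le> s" using \<open>\<not> 0 \<le> w\<close> unfolding s_def by (intro divide_nonneg_pos) auto
    ultimately show False using \<open>\<not> 0 \<le> w\<close> by (simp add: s_def)
  qed
  \<comment> \<open>The point \<open>q / w\<close> is the minimizer.\<close>
  with False assms[of "q / w"] show ?thesis
    by (simp add: field_simps power2_eq_square)
qed

text \<open>Along the line \<open>x - t y\<close> the form of \<open>A\<close> is a nonnegative
  quadratic in \<open>t\<close>.\<close>

lemma nonneg_definite_Cauchy_Schwarz:
  assumes "nonneg_definite A"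
  shows "(x \<bullet> (A *v y))\<^sup>2 \<le> (x \<bullet> (A *v x)) * (y \<bullet> (A *v y))"
proof (rule discriminant_le)
  fix t
  have sym: "y \<bullet> (A *v x) = x \<bullet> (A *v y)"
    using assms by (metis inner_commute inner_matrix_transpose nonneg_definite_def symmetric_matrix_def)
  have "0 \<le> (x - t *\<^sub>R y) \<bullet> (A *v (x - t *\<^sub>R y))"
    using assms by (simp add: nonneg_definite_def)
  also have "\<dots> = x \<bullet> (A *v x) - 2 * t * (x \<bullet> (A *v y)) + t\<^sup>2 * (y \<bullet> (A *v y))"
    by (simp add: matrix_vector_mult_diff_distrib matrix_vector_mult_scaleR inner_diff_left
        inner_diff_right sym power2_eq_square algebra_simps)
  finally show "0 \<le> \<dots>" .
qed

text \<open>Cauchy-Schwarz between \<open>A x\<close> and \<open>x\<close> bounds the fourth power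
  of the norm of \<open>A x\<close> by zero.\<close>

lemma nonneg_definite_ker:
  assumes "nonneg_definite A" "x \<bullet> (A *v x) = 0"
  shows "A *v x = 0"
  using nonneg_definite_Cauchy_Schwarz[OF assms(1), of "A *v x" x] assms(2) by auto

lemma matrix_vector_axis: "A *v axis s 1 = column s (A :: real^'n^'m)"
  by (simp add: matrix_vector_mul_component column_def vec_eq_iff matrix_vector_mult_def axis_def if_distrib cong: if_cong)

text \<open>Cholesky factorization: each step replaces the matrix by a Schur complement.\<close>

lemma nonneg_definite_sum_outer:
  fixes A :: "real^'n^'n"
  assumes "finite S" "nonneg_definite A" "\<And>i j. i \<notin> S \<Longrightarrow> A $ i $ j = 0"
  shows "\<exists>b :: 'n \<Rightarrow> real^'n. \<forall>i j. A $ i $ j = (\<Sum>s\<in>S. b s $ i * b s $ j)"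
  using assms
proof (induction S arbitrary: A rule: finite_induct)
  case empty
  then show ?case by simp
next
  case (insert s S)
  define c where "c = A *v axis s 1"
  \<comment> \<open>The Schur complement of the pivot \<open>A $ s $ s\<close>. For a zero pivot the
    quotient is 0 by convention and \<open>A' = A\<close>.\<close>
  define A' where "A' = (\<chi> i j. A $ i $ j - c $ i * c $ j / A $ s $ s)"
  have sym: "A $ i $ j = A $ j $ i" for i j
    using insert.prems(1) unfolding nonneg_definite_def symmetric_matrix_def
    by (metis transpose_def vec_lambda_beta)
  have c: "c $ i = A $ i $ s" for i
    by (simp add: c_def matrix_vector_axis column_def)
  have ss: "axis s 1 \<bullet> (A *v axis s 1) = A $ s $ s"
    by (simp add: matrix_vector_axis column_def inner_axis')
  then have ss0: "0 \<le> A $ s $ s"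
    using insert.prems(1) unfolding nonneg_definite_def by metis
  have CS: "(x \<bullet> c)\<^sup>2 \<le> (x \<bullet> (A *v x)) * A $ s $ s" for x
    using nonneg_definite_Cauchy_Schwarz[OF insert.prems(1), of x "axis s 1"] ss by (simp add: c_def)
  \<comment> \<open>A zero pivot forces its whole column to vanish, so row \<open>s\<close> of
    \<open>A'\<close> vanishes in this case as well.\<close>
  have c0: "c $ i = 0" if "A $ s $ s = 0" for i
    using CS[of "axis i 1"] that by (simp add: inner_axis')
  have A'v: "A' *v x = A *v x - ((x \<bullet> c) / A $ s $ s) *\<^sub>R c" for x
    by (simp add: A'_def vec_eq_iff matrix_vector_mult_def inner_vec_def sum_subtractf sum_distrib_left
       sum_distrib_right sum_divide_distrib right_diff_distrib mult_ac)
  have "nonneg_definite A'"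
    unfolding nonneg_definite_def
  proof safe
    show "symmetric_matrix A'"
      by (simp add: symmetric_matrix_def A'_def transpose_def vec_eq_iff sym mult.commute)
    fix x
    have "0 \<le> x \<bullet> (A *v x) - (x \<bullet> c)\<^sup>2 / A $ s $ s"
      using CS[of x] ss0 insert.prems(1) unfolding nonneg_definite_def
      by (cases "A $ s $ s = 0") (auto simp: field_simps)
    then show "0 \<le> x \<bullet> (A' *v x)"
      by (simp add: A'v inner_diff_right power2_eq_square)
  qed
  moreover have "A' $ i $ j = 0" if "i \<notin> S" for i j
  proof (cases "i = s")
    case True
    then show ?thesis
      using c0[of i] c0[of j] by (cases "A $ s $ s = 0") (simp_all add: A'_def c sym)
  next
    case False
    then show ?thesis
      using that insert.prems(2) by (simp add: A'_def c)
  qed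
  ultimately obtain b :: "'n \<Rightarrow> real^'n" where b: "\<And>i j. A' $ i $ j = (\<Sum>s\<in>S. b s $ i * b s $ j)"
    using insert.IH[of A'] by blast
  \<comment> \<open>The new vector is the pivot column divided by the root of the pivot; for a zero
    pivot it is the zero vector, in accordance with \<open>c0\<close>.\<close>
  have "A $ i $ j = (\<Sum>t\<in>insert s S. (b(s := (1 / sqrt (A $ s $ s)) *\<^sub>R c)) t $ i *
          (b(s := (1 / sqrt (A $ s $ s)) *\<^sub>R c)) t $ j)" for i j
  proof -
    have "(\<Sum>t\<in>S. (b(s := (1 / sqrt (A $ s $ s)) *\<^sub>R c)) t $ i * (b(s := (1 / sqrt (A $ s $ s)) *\<^sub>R c)) t $ j)
        = A' $ i $ j"
      unfolding b using insert.hyps(2) by (intro sum.cong) auto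
    then show ?thesis
      using insert.hyps ss0 by (simp add: A'_def)
  qed
  then show ?case by blast
qed

lemma nonneg_definite_factor:
  fixes A :: "real^'n^'n"
  assumes "nonneg_definite A"
  shows "\<exists>B :: real^'n^'n. B ** transpose B = A"
proof -
  obtain b :: "'n \<Rightarrow> real^'n" where "\<And>i j. A $ i $ j = (\<Sum>s\<in>UNIV. b s $ i * b s $ j)"
    using nonneg_definite_sum_outer[OF _ assms, of UNIV] by auto
  then have "(\<chi> i s. b s $ i) ** transpose (\<chi> i s. b s $ i) = A"
    by (simp add: matrix_matrix_mult_def transpose_def vec_eq_iff)
  then show ?thesis by blast
qed

text \<open>The norm of a matrix is the Frobenius norm, and row \<open>a\<close> of
  \<open>H B\<close> is \<open>B'\<close> applied to row \<open>a\<close> of \<open>H\<close>. Thus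
  the norm depends on the factor \<open>B\<close> only through the covariance
  \<open>B B'\<close>.\<close>

lemma norm_matrix_mult_factor:
  fixes H :: "real^'n^'m" and B :: "real^'n^'n"
  shows "(norm (H ** B))\<^sup>2 = (\<Sum>a\<in>UNIV. H $ a \<bullet> ((B ** transpose B) *v H $ a))"
proof -
  have "(H ** B) $ a = transpose B *v H $ a" for a
    by (simp add: matrix_matrix_mult_def matrix_vector_mult_def transpose_def vec_eq_iff mult.commute)
  then have *: "(norm ((H ** B) $ a))\<^sup>2 = H $ a \<bullet> ((B ** transpose B) *v H $ a)" for a
    by (simp add: power2_norm_eq_inner inner_matrix_transpose flip: matrix_vector_mul_assoc)
  have "(norm (H ** B))\<^sup>2 = (\<Sum>a\<in>UNIV. (norm ((H ** B) $ a))\<^sup>2)"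
    unfolding norm_vec_def[of "H ** B"] L2_set_def by (intro real_sqrt_pow2 sum_nonneg) simp
  then show ?thesis
    by (simp add: *)
qed

text \<open>The kernel of a nonzero matrix is a proper subspace, so it has smaller dimension and is
  negligible.\<close>

lemma AE_matrix_vector_nonzero:
  fixes S :: "real^'n^'m"
  assumes "S \<noteq> 0"
  shows "AE z in lborel. S *v z \<noteq> 0"
proof -
  have sub: "subspace {z. S *v z = 0}"
    by (auto simp: subspace_def matrix_vector_right_distrib matrix_vector_mult_scaleR)
  moreover have "{z. S *v z = 0} \<noteq> UNIV"
    using assms matrix_eq[of S 0] by auto
  ultimately have "dim {z. S *v z = 0} < DIM(real^'n)"
    by (metis dim_eq_full dim_subset_UNIV less_le span_eq_iff)
  then have "negligible {z. S *v z = 0}"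
    by (rule negligible_lowdim)
  \<comment> \<open>Closedness makes the kernel a Borel set, hence null for \<open>lborel\<close>
    itself and not merely for its completion.\<close>
  moreover have "closed {z. S *v z = 0}"
    using sub by (rule closed_subspace)
  ultimately have "{z. S *v z = 0} \<in> null_sets lborel"
    by (simp add: negligible_iff_null_sets null_sets_completion_iff)
  then show ?thesis
    using AE_not_in by fastforce
qed

text \<open>If \<open>S B\<close> vanished, so would \<open>S (B C)\<close>, and then
  \<open>S\<close>. The intended \<open>C\<close> is the transpose of a covariance factor
  \<open>B\<close>.\<close>

lemma matrix_mult_invertible_right_nonzero:
  fixes S :: "real^'n^'m" and B C :: "real^'n^'n"
  assumes "S \<noteq> 0" "invertible (B ** C)"
  shows "S ** B \<noteq> 0"
proof
  assume "S ** B = 0"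
  then have "S ** (B ** C) ** matrix_inv (B ** C) = 0"
    by (simp add: matrix_mul_assoc)
  then show False
    using assms matrix_inv_right[OF assms(2)] by (simp flip: matrix_mul_assoc)
qed

section \<open>Gaussian measures\<close>

text \<open>The density is a product over coordinates. Rewriting it as a product over
  \<open>Basis\<close> lets the integral split into one-dimensional normal integrals.\<close>

lemma prob_space_std_gaussian: "prob_space (std_gaussian :: (real^'n) measure)"
proof
  have Basis: "Basis = range (\<lambda>i. axis i 1 :: real^'n)"
    by (auto simp: Basis_vec_def)
  have inj: "inj (\<lambda>i. axis i 1 :: real^'n)"
    by (auto simp: inj_def axis_eq_axis)
  have "emeasure (std_gaussian :: (real^'n) measure) (space std_gaussian) =
      (\<integral>\<^sup>+ z. (\<Prod>i\<in>UNIV. ennreal (std_normal_density (z $ i))) \<partial>(lborel :: (real^'n) measure))"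
    by (simp add: std_gaussian_def emeasure_density prod_ennreal)
  also have "\<dots> = (\<integral>\<^sup>+ z. (\<Prod>b\<in>Basis. ennreal (std_normal_density (z \<bullet> b))) \<partial>(lborel :: (real^'n) measure))"
    by (simp add: Basis prod.reindex[OF inj] inner_axis)
  also have "\<dots> = (\<Prod>b\<in>(Basis :: (real^'n) set). \<integral>\<^sup>+ x. ennreal (std_normal_density x) \<partial>lborel)"
    by (rule nn_integral_lborel_prod) auto
  also have "(\<integral>\<^sup>+ x. ennreal (std_normal_density x) \<partial>lborel) = 1"
    using prob_space.emeasure_space_1[OF prob_space_normal_density[of 1 0]] by (simp add: emeasure_density)
  finally show "emeasure (std_gaussian :: (real^'n) measure) (space std_gaussian) = 1" by simp
qed

lemma space_std_gaussian [simp]: "space std_gaussian = UNIV"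
  and sets_std_gaussian [simp, measurable_cong]: "sets std_gaussian = sets borel"
  by (simp_all add: std_gaussian_def)

lemma AE_std_gaussian: "AE z in lborel. P z \<Longrightarrow> AE z in std_gaussian. P z"
  unfolding std_gaussian_def by (subst AE_density) auto

lemma borel_measurable_affine [measurable]:
  "(\<lambda>z. \<mu> + (B :: real^'n^'m) *v z) \<in> borel_measurable borel"
  by (intro borel_measurable_continuous_onI continuous_intros
      matrix_vector_mult_linear_continuous_on[unfolded eta_contract_eq])

lemma prob_space_gaussian: "prob_space (gaussian \<mu> A)"
  unfolding gaussian_def by (intro prob_space.prob_space_distr prob_space_std_gaussian) simp

lemma tendsto_matrix_vector_mult:
  fixes L :: "'a \<Rightarrow> real^'n^'m"
  assumes "(L \<longlongrightarrow> L') F"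
  shows "((\<lambda>i. L i *v z) \<longlongrightarrow> L' *v z) F"
  unfolding matrix_vector_mult_def
  by (intro tendsto_vec_lambda tendsto_sum tendsto_mult tendsto_const tendsto_vec_nth assms)

text \<open>After division by the norm of \<open>H B\<close>, the matrices lie on a compact sphere,
  so a subsequence converges to some nonzero \<open>L'\<close>. Off the null kernel of
  \<open>L'\<close> the form of \<open>V\<close> has a positive limit, while the form of
  \<open>W\<close> tends to zero. The exceptional set is the same for all \<open>C\<close>.\<close>

lemma subsequence_quadratic_dominates:
  fixes H :: "real^'n^'q" and P :: "real^'n^'p" and B :: "nat \<Rightarrow> real^'n^'n" and V :: "real^'q^'q"
  assumes nz: "\<And>m. H ** B m \<noteq> 0"
    and lim: "(\<lambda>m. norm (P ** B m) / norm (H ** B m)) \<longlonglongrightarrow> 0"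
    and V: "\<And>x. x \<noteq> 0 \<Longrightarrow> 0 < x \<bullet> (V *v x)"
  obtains k :: "nat \<Rightarrow> nat" where "strict_mono k"
    and "AE z in lborel. \<forall>C. \<forall>\<^sub>F i in sequentially.
      C * ((P ** B (k i) *v z) \<bullet> (W *v (P ** B (k i) *v z)))
        < (H ** B (k i) *v z) \<bullet> (V *v (H ** B (k i) *v z))"
proof -
  define L where "L m = (1 / norm (H ** B m)) *\<^sub>R (H ** B m)" for m
  define N where "N m = (1 / norm (H ** B m)) *\<^sub>R (P ** B m)" for m
  have "L m \<in> sphere 0 1" for m
    using nz by (simp add: L_def)
  then obtain L' k where L': "L' \<in> sphere 0 1" and k: "strict_mono k" and conv: "(L \<circ> k) \<longlonglongrightarrow> L'"
    by (metis compact_sphere compact_imp_seq_compact seq_compactE)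
  have "N \<longlonglongrightarrow> 0"
    by (rule tendsto_norm_zero_cancel) (use lim in \<open>simp add: N_def divide_inverse mult.commute\<close>)
  then have N0: "(\<lambda>i. N (k i)) \<longlonglongrightarrow> 0"
    using k by (rule LIMSEQ_subseq_LIMSEQ[unfolded o_def])
  have "AE z in lborel. L' *v z \<noteq> 0"
    using L' by (intro AE_matrix_vector_nonzero) auto
  then have "AE z in lborel. \<forall>C. \<forall>\<^sub>F i in sequentially.
      C * ((P ** B (k i) *v z) \<bullet> (W *v (P ** B (k i) *v z)))
        < (H ** B (k i) *v z) \<bullet> (V *v (H ** B (k i) *v z))"
  proof (rule AE_mp, intro AE_I2 impI allI)
    fix z C assume z: "L' *v z \<noteq> 0"
    have Lz: "(\<lambda>i. L (k i) *v z) \<longlonglongrightarrow> L' *v z"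
      using conv by (intro tendsto_matrix_vector_mult) (simp add: o_def)
    have Nz: "(\<lambda>i. N (k i) *v z) \<longlonglongrightarrow> 0"
      using tendsto_matrix_vector_mult[OF N0] by simp
    have mult: "(\<lambda>i. A *v x i) \<longlonglongrightarrow> A *v y" if "x \<longlonglongrightarrow> y" for A :: "real^'a^'b" and x y
      by (rule isCont_tendsto_compose[OF _ that]) (simp add: linear_continuous_at matrix_vector_mul_bounded_linear)
    have "(\<lambda>i. (L (k i) *v z) \<bullet> (V *v (L (k i) *v z))
        - C * ((N (k i) *v z) \<bullet> (W *v (N (k i) *v z))))
      \<longlonglongrightarrow> (L' *v z) \<bullet> (V *v (L' *v z)) - C * (0 \<bullet> (W *v 0))"
      by (intro tendsto_intros Lz Nz mult)
    moreover have "(L' *v z) \<bullet> (V *v (L' *v z)) - C * (0 \<bullet> (W *v 0)) > 0"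
      using V z by simp
    ultimately have "\<forall>\<^sub>F i in sequentially. 0 < (L (k i) *v z) \<bullet> (V *v (L (k i) *v z))
        - C * ((N (k i) *v z) \<bullet> (W *v (N (k i) *v z)))"
      by (rule order_tendstoD)
    then show "\<forall>\<^sub>F i in sequentially. C * ((P ** B (k i) *v z) \<bullet> (W *v (P ** B (k i) *v z)))
        < (H ** B (k i) *v z) \<bullet> (V *v (H ** B (k i) *v z))"
    proof eventually_elim
      case (elim i)
      define t where "t = norm (H ** B (k i))"
      have "t > 0" using nz by (simp add: t_def)
      \<comment> \<open>Both forms are homogeneous of degree two, so the common normalization
        factors out.\<close>
      have "0 < (1 / t)\<^sup>2 * ((H ** B (k i) *v z) \<bullet> (V *v (H ** B (k i) *v z))
         - C * ((P ** B (k i) *v z) \<bullet> (W *v (P ** B (k i) *v z))))"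
        using elim by (simp add: L_def N_def t_def[symmetric] matrix_vector_mult_scaleR power2_eq_square
          right_diff_distrib flip: scaleR_matrix_vector_assoc)
      then show ?case
        using \<open>t > 0\<close> by (simp add: zero_less_mult_iff)
    qed
  qed
  with k that show thesis by blast
qed

text \<open>Dominated convergence applied to the indicators.\<close>

lemma measure_tendsto_1:
  assumes "prob_space M" "\<And>i. D i \<in> sets M" "AE z in M. \<forall>\<^sub>F i in sequentially. z \<in> D i"
  shows "(\<lambda>i. measure M (D i)) \<longlonglongrightarrow> 1"
proof -
  interpret prob_space M by fact
  have "(\<lambda>i. \<integral>z. indicator (D i) z \<partial>M) \<longlonglongrightarrow> (\<integral>z. (1::real) \<partial>M)"
  proof (rule integral_dominated_convergence[where w = "\<lambda>_. 1"])
    show "AE z in M. (\<lambda>i. indicator (D i) z) \<longlonglongrightarrow> (1::real)"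
      using assms(3)
    proof eventually_elim
      case (elim z)
      then show ?case
        by (intro tendsto_eventually) (auto elim: eventually_mono)
    qed
  qed (use assms(2) in \<open>auto simp: indicator_def\<close>)
  moreover have "D i \<inter> space M = D i" for i
    using assms(2) sets.sets_into_space by blast
  ultimately show ?thesis
    using assms(2) by (simp add: prob_space)
qed

section \<open>Autoregressive spectral densities\<close>

text \<open>
  A process with a prescribed spectral density \<open>f\<close>: \<open>Y\<^sub>t = cos (t \<Omega> + U)\<close>, where \<open>\<Omega>\<close> has
  density \<open>f\<close> and the phase \<open>U\<close> is independent and uniform on \<open>{0, \<pi>/2, \<pi>, 3\<pi>/2}\<close>.
\<close>

lemma random_phase_process:
  fixes f :: "real \<Rightarrow> real"
  assumes cont: "continuous_on {-pi..pi} f"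
    and nonneg: "\<And>\<omega>. \<omega> \<in> {-pi..pi} \<Longrightarrow> 0 \<le> f \<omega>"
    and int1: "integral {-pi..pi} f = 1"
  obtains M :: "(int \<Rightarrow> real) measure" and Y :: "int \<Rightarrow> (int \<Rightarrow> real) \<Rightarrow> real"
  where "prob_space M"
    and "\<And>t. Y t \<in> borel_measurable M"
    and "\<And>t. integrable M (Y t)"
    and "\<And>s t. integrable M (\<lambda>x. Y s x * Y t x)"
    and "\<And>t. (\<integral>x. Y t x \<partial>M) = 0"
    and "\<And>s t. (\<integral>x. Y s x * Y t x \<partial>M) = integral {-pi..pi} (\<lambda>\<omega>. cos (of_int (s - t) * \<omega>) * f \<omega>) / 2"
proof -
  define dens where "dens x = indicator {-pi..pi} x * f x" for x
  define N where "N = density lborel (\<lambda>x. ennreal (dens x))"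
  define U where "U = measure_pmf (pmf_of_set {..<4::nat})"
  define y where "y t p = cos (of_int t * fst p + real (snd p) * (pi / 2))" for t :: int and p :: "real \<times> nat"
  define P where "P = N \<Otimes>\<^sub>M U"
  have dens_int: "integrable lborel dens"
    using borel_integrable_compact[OF _ cont] by (simp add: dens_def[abs_def])
  then have dens_meas [measurable]: "dens \<in> borel_measurable borel" by auto
  have dens0: "0 \<le> dens x" for x
    using nonneg by (simp add: dens_def indicator_def)
  have N_int: "(\<integral>x. g x \<partial>N) = integral {-pi..pi} (\<lambda>x. g x * f x)" if g: "continuous_on UNIV g" for g :: "real \<Rightarrow> real"
  proof -
    have [measurable]: "g \<in> borel_measurable borel"
      using g by (rule borel_measurable_continuous_onI)
    have "set_integrable lborel {-pi..pi} (\<lambda>x. g x * f x)"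
      by (intro borel_integrable_atLeastAtMost' continuous_on_mult cont) (rule continuous_on_subset[OF g], simp)
    then have "(LINT x : {-pi..pi} | lborel. g x * f x) = integral {-pi..pi} (\<lambda>x. g x * f x)"
      by (rule set_borel_integral_eq_integral)
    moreover have "(\<integral>x. g x \<partial>N) = (\<integral>x. dens x *\<^sub>R g x \<partial>lborel)"
      unfolding N_def by (rule integral_density) (auto simp: dens0)
    ultimately show ?thesis
      by (simp add: dens_def set_lebesgue_integral_def mult_ac)
  qed
  have "prob_space N"
  proof
    have "(\<integral>x. dens x \<partial>lborel) = 1"
      using set_borel_integral_eq_integral(2)[OF borel_integrable_atLeastAtMost'[OF cont]] int1
      by (simp add: dens_def[abs_def] set_lebesgue_integral_def)
    moreover have "emeasure N (space N) = (\<integral>\<^sup>+ x. ennreal (dens x) \<partial>lborel)"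
      by (simp add: N_def emeasure_density)
    ultimately show "emeasure N (space N) = 1"
      using nn_integral_eq_integral[OF dens_int] dens0 by simp
  qed
  moreover have "prob_space U" by (simp add: U_def measure_pmf.prob_space_axioms)
  ultimately interpret NU: pair_prob_space N U
    by (simp add: pair_prob_space_def pair_sigma_finite_def prob_space_imp_sigma_finite)
  have [measurable_cong]: "sets N = sets borel" by (simp add: N_def)
  have [measurable]: "fst \<in> borel_measurable P"
    unfolding P_def by (rule measurable_compose[OF measurable_fst, of "\<lambda>x. x"]) (simp add: N_def)
  have [measurable]: "(\<lambda>p. real (snd p)) \<in> borel_measurable P"
    unfolding P_def by (rule measurable_compose[OF measurable_snd]) (simp add: U_def)
  have y_meas [measurable]: "y t \<in> borel_measurable P" for t
    unfolding y_def[abs_def] by measurable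
  have P: "prob_space P" unfolding P_def by (rule NU.prob_space_axioms)
  interpret P: prob_space P by (rule P)
  have y_bd: "\<bar>y t p\<bar> \<le> 1" for t p by (simp add: y_def)
  have y_int: "integrable P (y t)" for t
    by (rule P.integrable_const_bound[of _ 1]) (auto simp: y_bd)
  have yy_int: "integrable P (\<lambda>p. y s p * y t p)" for s t
    by (rule P.integrable_const_bound[of _ 1]) (auto simp: y_bd abs_mult intro!: mult_le_one)
  have U_int: "(\<integral>k. g k \<partial>U) = (g 0 + g 1 + g 2 + g 3) / 4" for g :: "nat \<Rightarrow> real"
    unfolding U_def by (subst integral_pmf_of_set) (auto simp: eval_nat_numeral lessThan_Suc lessThan_empty_iff)
  \<comment> \<open>The four phases turn \<open>cos a\<close> into \<open>cos a\<close>,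
    \<open>- sin a\<close>, \<open>- cos a\<close> and \<open>sin a\<close>, whose sum is
    zero.\<close>
  have shift: "cos (a + 3 * pi / 2) = sin a" "cos (a + pi / 2) = - sin a" for a
    using cos_add[of a "pi / 2"] cos_periodic_pi[of "a + pi / 2"] by (simp_all add: algebra_simps)
  have Ey: "(\<integral>p. y t p \<partial>P) = 0" for t
  proof -
    have "(\<integral>p. y t p \<partial>P) = (\<integral>x. (\<integral>k. y t (x, k) \<partial>U) \<partial>N)"
      unfolding P_def by (rule NU.integral_fst'[symmetric]) (use y_int in \<open>simp add: P_def\<close>)
    moreover have "(\<integral>k. y t (x, k) \<partial>U) = 0" for x
      by (simp add: U_int y_def shift)
    ultimately show ?thesis by simp
  qed
  have Eyy: "(\<integral>p. y s p * y t p \<partial>P) = integral {-pi..pi} (\<lambda>\<omega>. cos (of_int (s - t) * \<omega>) * f \<omega>) / 2" for s t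
  proof -
    \<comment> \<open>Averaging over the phase leaves half of
      \<open>cos a cos b + sin a sin b\<close>, so only the lag survives.\<close>
    have *: "(\<integral>k. y s (x, k) * y t (x, k) \<partial>U) = cos (of_int (s - t) * x) / 2" for x
      by (simp add: U_int y_def shift left_diff_distrib cos_diff)
    have "(\<integral>p. y s p * y t p \<partial>P) = (\<integral>x. (\<integral>k. y s (x, k) * y t (x, k) \<partial>U) \<partial>N)"
      unfolding P_def by (rule NU.integral_fst'[symmetric]) (use yy_int in \<open>simp add: P_def\<close>)
    also have "\<dots> = integral {-pi..pi} (\<lambda>x. cos (of_int (s - t) * x) / 2 * f x)"
      unfolding * by (rule N_int) (auto intro!: continuous_intros)
    also have "\<dots> = integral {-pi..pi} (\<lambda>x. cos (of_int (s - t) * x) * f x) / 2"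
      by simp
    finally show ?thesis .
  qed
  \<comment> \<open>\<open>F_AR2\<close> asks for a measure on path space, so the process is
    replaced by the coordinate process under its law.\<close>
  define M where "M = distr P (Pi\<^sub>M UNIV (\<lambda>_. borel)) (\<lambda>p t. y t p)"
  have path: "(\<lambda>p t. y t p) \<in> measurable P (Pi\<^sub>M UNIV (\<lambda>_. borel))"
    by (rule measurable_PiM_single') (auto simp: y_meas)
  have coord [measurable]: "(\<lambda>w. w t) \<in> borel_measurable (Pi\<^sub>M UNIV (\<lambda>_. borel))" for t :: int
    by (rule measurable_component_singleton) simp
  show thesis
  proof (rule that[of M "\<lambda>t w. w t"])
    show "prob_space M" unfolding M_def using path by (rule P.prob_space_distr)
    show "(\<lambda>w. w t) \<in> borel_measurable M" for t
      by (simp add: M_def)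
    show "integrable M (\<lambda>w. w t)" for t
      unfolding M_def by (subst integrable_distr_eq[OF path]) (auto simp: y_int)
    show "integrable M (\<lambda>w. w s * w t)" for s t
      unfolding M_def by (subst integrable_distr_eq[OF path]) (auto simp: yy_int)
    show "(\<integral>w. w t \<partial>M) = 0" for t
      unfolding M_def by (subst integral_distr[OF path]) (auto simp: Ey)
    show "(\<integral>w. w s * w t \<partial>M) = integral {-pi..pi} (\<lambda>\<omega>. cos (of_int (s - t) * \<omega>) * f \<omega>) / 2" for s t
      unfolding M_def by (subst integral_distr[OF path]) (auto simp: Eyy)
  qed
qed

text \<open>The sine part has an odd integrand and integrates to zero.\<close>

lemma integral_exp_mult_even:
  fixes f :: "real \<Rightarrow> real"
  assumes cont: "continuous_on {-pi..pi} f" and even: "\<forall>\<omega>\<in>{-pi..pi}. f (- \<omega>) = f \<omega>"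
  shows "integral {-pi..pi} (\<lambda>\<omega>. exp (\<i> * of_int h * of_real \<omega>) * of_real (f \<omega>))
    = complex_of_real (integral {-pi..pi} (\<lambda>\<omega>. cos (of_int h * \<omega>) * f \<omega>))"
proof -
  have s: "((\<lambda>\<omega>. sin (of_int h * \<omega>) * f \<omega>) has_integral integral {-pi..pi} (\<lambda>\<omega>. sin (of_int h * \<omega>) * f \<omega>)) {-pi..pi}"
    and c: "((\<lambda>\<omega>. cos (of_int h * \<omega>) * f \<omega>) has_integral integral {-pi..pi} (\<lambda>\<omega>. cos (of_int h * \<omega>) * f \<omega>)) {-pi..pi}"
    by (intro integrable_integral integrable_continuous_interval continuous_intros cont)+
  have "integral {-pi..pi} (\<lambda>\<omega>. sin (of_int h * \<omega>) * f \<omega>) =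
     integral {-pi..pi} (\<lambda>\<omega>. (\<lambda>\<omega>. sin (of_int h * \<omega>) * f \<omega>) (- \<omega>))"
    using Henstock_Kurzweil_Integration.integral_reflect_real[of pi "-pi" "\<lambda>\<omega>. sin (of_int h * \<omega>) * f \<omega>"] by simp
  also have "\<dots> = integral {-pi..pi} (\<lambda>\<omega>. - (sin (of_int h * \<omega>) * f \<omega>))"
    by (rule integral_cong) (use even in auto)
  finally have "integral {-pi..pi} (\<lambda>\<omega>. sin (of_int h * \<omega>) * f \<omega>) = 0" by simp
  with s have "((\<lambda>\<omega>. sin (of_int h * \<omega>) * f \<omega>) has_integral 0) {-pi..pi}" by simp
  then have "((\<lambda>\<omega>. of_real (cos (of_int h * \<omega>) * f \<omega>) + \<i> * of_real (sin (of_int h * \<omega>) * f \<omega>))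
     has_integral (of_real (integral {-pi..pi} (\<lambda>\<omega>. cos (of_int h * \<omega>) * f \<omega>)) + \<i> * of_real 0)) {-pi..pi}"
    by (intro has_integral_add has_integral_mult_right has_integral_of_real c)
  moreover have "exp (\<i> * of_int h * of_real \<omega>) * of_real (f \<omega>) =
     of_real (cos (of_int h * \<omega>) * f \<omega>) + \<i> * of_real (sin (of_int h * \<omega>) * f \<omega>)" for \<omega>
    using cis_conv_exp[of "of_int h * \<omega>"] by (simp add: cis.ctr complex_eq_iff mult_ac)
  ultimately show ?thesis
    by (simp add: integral_unique)
qed

lemma integral_cos_period:
  "integral {-pi..pi} (\<lambda>\<omega>. cos (of_int h * \<omega>)) = (if h = 0 then 2 * pi else 0)"
proof (cases "h = 0")
  case False
  have "((\<lambda>\<omega>. cos (of_int h * \<omega>)) has_integral sin (of_int h * pi) / of_int h - sin (of_int h * (-pi)) / of_int h) {-pi..pi}"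
    by (intro fundamental_theorem_of_calculus)
      (use False in \<open>auto intro!: derivative_eq_intros simp flip: has_real_derivative_iff_has_vector_derivative\<close>)
  moreover have "sin (of_int h * pi) = 0"
    by (simp add: mult.commute sin_zero_iff_int2)
  ultimately show ?thesis using False by (simp add: integral_unique)
qed simp

text \<open>The squared modulus of \<open>1 - a1 z - a2 z\<^sup>2\<close> at \<open>z = exp (- \<i> \<omega>)\<close>.\<close>

definition AR2_denominator :: "real \<Rightarrow> real \<Rightarrow> real \<Rightarrow> real" where
  "AR2_denominator a1 a2 \<omega> = 1 + a1\<^sup>2 + a2\<^sup>2 - 2 * a1 * (1 - a2) * cos \<omega> - 2 * a2 * cos (2 * \<omega>)"

text \<open>A process with spectral density \<open>f\<close> exists by the random phase
  construction. Applying the autoregressive filter to it multiplies the density by the denominator,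
  which leaves the constant \<open>c\<close>: the filtered process is white noise.\<close>

lemma F_AR2_I:
  fixes a1 a2 c :: real
  assumes pos: "\<And>\<omega>. 0 < AR2_denominator a1 a2 \<omega>" and "0 < c"
    and int1: "integral {-pi..pi} (\<lambda>\<omega>. c / AR2_denominator a1 a2 \<omega>) = 1"
  shows "restrict (\<lambda>\<omega>. c / AR2_denominator a1 a2 \<omega>) {-pi..pi} \<in> F_AR2"
proof -
  define D where "D = AR2_denominator a1 a2"
  define f where "f = restrict (\<lambda>\<omega>. c / D \<omega>) {-pi..pi}"
  have D0: "D \<omega> \<noteq> 0" for \<omega> using pos[of \<omega>] by (simp add: D_def)
  have contD: "continuous_on A D" for A
    unfolding D_def AR2_denominator_def[abs_def] by (intro continuous_intros)
  have cont: "continuous_on {-pi..pi} f"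
    unfolding f_def by (subst continuous_on_cong[OF refl restrict_apply']) (auto intro!: continuous_intros contD D0)
  have f: "f \<omega> = c / D \<omega>" if "\<omega> \<in> {-pi..pi}" for \<omega> using that by (simp add: f_def)
  have f0: "0 \<le> f \<omega>" if "\<omega> \<in> {-pi..pi}" for \<omega>
    using that pos[of \<omega>] \<open>0 < c\<close> by (simp add: f D_def)
  have even: "\<forall>\<omega>\<in>{-pi..pi}. f (- \<omega>) = f \<omega>"
    by (simp add: f D_def AR2_denominator_def)
  have f1: "integral {-pi..pi} f = 1"
    using int1 by (subst integral_cong[OF f]) (auto simp: D_def)
  have "f \<in> F_all"
    unfolding F_all_def using f0 even f1 cont
    by (auto simp: absolutely_integrable_continuous_real f_def)
  obtain M :: "(int \<Rightarrow> real) measure" and Y :: "int \<Rightarrow> (int \<Rightarrow> real) \<Rightarrow> real" where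
    M: "prob_space M" and [measurable]: "\<And>t. Y t \<in> borel_measurable M"
    and Y1 [simp]: "\<And>t. integrable M (Y t)" and Y2 [simp]: "\<And>s t. integrable M (\<lambda>x. Y s x * Y t x)"
    and EY [simp]: "\<And>t. (\<integral>x. Y t x \<partial>M) = 0"
    and EYY: "\<And>s t. (\<integral>x. Y s x * Y t x \<partial>M) = integral {-pi..pi} (\<lambda>\<omega>. cos (of_int (s - t) * \<omega>) * f \<omega>) / 2"
    by (rule random_phase_process[OF cont f0 f1]; (assumption | rule that))
  define J where "J h = integral {-pi..pi} (\<lambda>\<omega>. cos (of_int h * \<omega>) * f \<omega>)" for h :: int
  have EYJ: "(\<integral>x. Y s x * Y t x \<partial>M) = J (s - t) / 2" for s t by (simp add: EYY J_def)
  have J_int: "(\<lambda>\<omega>. cos (of_int h * \<omega>) * f \<omega>) integrable_on {-pi..pi}" for h :: int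
    by (intro integrable_continuous_interval continuous_intros cont)
  have J_neg: "J (- h) = J h" for h by (simp add: J_def)
  \<comment> \<open>With the innovations defined as filter output, the autoregressive equation holds
    identically; only their whiteness needs proof.\<close>
  define e where "e t x = Y t x - a1 * Y (t - 1) x - a2 * Y (t - 2) x" for t x
  have e_meas [measurable]: "e t \<in> borel_measurable M" for t
    unfolding e_def[abs_def] by measurable
  have Ee [simp]: "(\<integral>x. e t x \<partial>M) = 0" for t by (simp add: e_def)
  have ee: "(\<lambda>x. e s x * e t x) = (\<lambda>x. Y s x * Y t x - a1 * (Y s x * Y (t - 1) x) - a2 * (Y s x * Y (t - 2) x)
      - a1 * (Y (s - 1) x * Y t x) + a1\<^sup>2 * (Y (s - 1) x * Y (t - 1) x) + a1 * a2 * (Y (s - 1) x * Y (t - 2) x)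
      - a2 * (Y (s - 2) x * Y t x) + a1 * a2 * (Y (s - 2) x * Y (t - 1) x) + a2\<^sup>2 * (Y (s - 2) x * Y (t - 2) x))" for s t
    by (simp add: e_def fun_eq_iff power2_eq_square algebra_simps)
  have ee_int [simp]: "integrable M (\<lambda>x. e s x * e t x)" for s t
    unfolding ee by simp
  \<comment> \<open>Filtering at the level of autocovariances: the coefficients assemble to
    \<open>D \<omega> * f \<omega> = c\<close> under the integral, and orthogonality of the cosines
    leaves only lag 0.\<close>
  have J_comb: "(1 + a1\<^sup>2 + a2\<^sup>2) * J h - a1 * (1 - a2) * (J (h + 1) + J (h - 1)) - a2 * (J (h + 2) + J (h - 2))
     = (if h = 0 then 2 * pi * c else 0)" for h
  proof -
    have "(1 + a1\<^sup>2 + a2\<^sup>2) * J h - a1 * (1 - a2) * (J (h + 1) + J (h - 1)) - a2 * (J (h + 2) + J (h - 2))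
      = integral {-pi..pi} (\<lambda>\<omega>. (1 + a1\<^sup>2 + a2\<^sup>2) * (cos (of_int h * \<omega>) * f \<omega>)
         - a1 * (1 - a2) * (cos (of_int (h + 1) * \<omega>) * f \<omega> + cos (of_int (h - 1) * \<omega>) * f \<omega>)
         - a2 * (cos (of_int (h + 2) * \<omega>) * f \<omega> + cos (of_int (h - 2) * \<omega>) * f \<omega>))"
      unfolding J_def
      by (intro integral_unique[symmetric] has_integral_diff has_integral_mult_right has_integral_add
          integrable_integral J_int)
    also have "\<dots> = integral {-pi..pi} (\<lambda>\<omega>. c * cos (of_int h * \<omega>))"
    proof (rule integral_cong)
      fix \<omega> assume w: "\<omega> \<in> {-pi..pi}"
      have "(1 + a1\<^sup>2 + a2\<^sup>2) * (cos (of_int h * \<omega>) * f \<omega>)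
         - a1 * (1 - a2) * (cos (of_int (h + 1) * \<omega>) * f \<omega> + cos (of_int (h - 1) * \<omega>) * f \<omega>)
         - a2 * (cos (of_int (h + 2) * \<omega>) * f \<omega> + cos (of_int (h - 2) * \<omega>) * f \<omega>)
         = cos (of_int h * \<omega>) * D \<omega> * f \<omega>"
        by (simp add: D_def AR2_denominator_def distrib_right left_diff_distrib cos_add cos_diff)
          (simp add: algebra_simps)
      then show "(1 + a1\<^sup>2 + a2\<^sup>2) * (cos (of_int h * \<omega>) * f \<omega>)
         - a1 * (1 - a2) * (cos (of_int (h + 1) * \<omega>) * f \<omega> + cos (of_int (h - 1) * \<omega>) * f \<omega>)
         - a2 * (cos (of_int (h + 2) * \<omega>) * f \<omega> + cos (of_int (h - 2) * \<omega>) * f \<omega>) = c * cos (of_int h * \<omega>)"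
        using f[OF w] D0 by simp
    qed
    finally show ?thesis by (simp add: integral_cos_period)
  qed
  \<comment> \<open>The variance is half of \<open>2 * pi * c\<close> because the random phase
    process has variance 1/2.\<close>
  have Eee: "(\<integral>x. e s x * e t x \<partial>M) = (if s = t then pi * c else 0)" for s t
  proof -
    have "(\<integral>x. e s x * e t x \<partial>M) = ((1 + a1\<^sup>2 + a2\<^sup>2) * J (s - t) - a1 * (1 - a2) * (J (s - t + 1) + J (s - t - 1))
       - a2 * (J (s - t + 2) + J (s - t - 2))) / 2"
      unfolding ee by (simp add: EYJ) (simp add: algebra_simps)
    then show ?thesis unfolding J_comb by (auto split: if_splits)
  qed
  have covY: "covariance M (Y s) (Y t) = J (s - t) / 2" for s t by (simp add: covariance_def EYJ)
  have cove: "covariance M (e s) (e t) = (if s = t then pi * c else 0)" for s t by (simp add: covariance_def Eee)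
  have statY: "weakly_stationary M Y"
    unfolding weakly_stationary_def using M by (simp add: covY power2_eq_square)
  have "weakly_stationary M e"
    unfolding weakly_stationary_def using M by (simp add: cove power2_eq_square)
  then have "white_noise M e"
    unfolding white_noise_def using \<open>0 < c\<close> by (simp add: cove)
  moreover have "Y t x = a1 * Y (t - 1) x + a2 * Y (t - 2) x + e t x" for t x by (simp add: e_def)
  ultimately have "stationary_AR2 M Y"
    unfolding stationary_AR2_def using statY by blast
  moreover have "J 0 = 1" using f1 by (simp add: J_def)
  then have "normalized_spectral_density M Y f"
    unfolding normalized_spectral_density_def
    by (subst integral_exp_mult_even[OF cont even]) (auto simp: covY J_def)
  ultimately have "f \<in> F_AR2"
    unfolding F_AR2_def using \<open>f \<in> F_all\<close> cont by blast
  then show ?thesis by (simp add: f_def D_def)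
qed

text \<open>With these coefficients \<open>1 - a1 z - a2 z\<^sup>2\<close> splits into linear
  factors with inverse roots of modulus \<rho> and argument plus or minus \<gamma>. Each bracket is
  the squared modulus of one factor on the unit circle.\<close>

lemma AR2_denominator_polar:
  "AR2_denominator (2 * \<rho> * cos \<gamma>) (- \<rho>\<^sup>2) \<omega> =
     ((1 - \<rho>)\<^sup>2 + 2 * \<rho> * (1 - cos (\<omega> - \<gamma>))) * ((1 - \<rho>)\<^sup>2 + 2 * \<rho> * (1 - cos (\<omega> + \<gamma>)))"
proof -
  have "cos (\<omega> - \<gamma>) * cos (\<omega> + \<gamma>) = (cos \<omega>)\<^sup>2 * (cos \<gamma>)\<^sup>2 - (sin \<omega>)\<^sup>2 * (sin \<gamma>)\<^sup>2"
    by (simp add: cos_add cos_diff power2_eq_square algebra_simps)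
  also have "\<dots> = (cos \<omega>)\<^sup>2 + (cos \<gamma>)\<^sup>2 - 1"
    by (simp add: sin_squared_eq algebra_simps)
  finally have prod: "cos (\<omega> - \<gamma>) * cos (\<omega> + \<gamma>) = (cos \<omega>)\<^sup>2 + (cos \<gamma>)\<^sup>2 - 1" .
  have sum: "cos (\<omega> - \<gamma>) + cos (\<omega> + \<gamma>) = 2 * cos \<omega> * cos \<gamma>"
    by (simp add: cos_add cos_diff)
  have "((1 - \<rho>)\<^sup>2 + 2 * \<rho> * (1 - cos (\<omega> - \<gamma>))) * ((1 - \<rho>)\<^sup>2 + 2 * \<rho> * (1 - cos (\<omega> + \<gamma>)))
    = (1 + \<rho>\<^sup>2)\<^sup>2 - 2 * \<rho> * (1 + \<rho>\<^sup>2) * (cos (\<omega> - \<gamma>) + cos (\<omega> + \<gamma>)) + 4 * \<rho>\<^sup>2 * (cos (\<omega> - \<gamma>) * cos (\<omega> + \<gamma>))"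
    by (simp add: power2_eq_square algebra_simps)
  then show ?thesis
    unfolding prod sum AR2_denominator_def cos_double_cos
    by (simp add: power2_eq_square algebra_simps)
qed

lemma one_minus_cos_le: "1 - cos x \<le> x\<^sup>2 / (2 :: real)"
proof -
  have "cos x = 1 - 2 * (sin (x / 2))\<^sup>2"
    using cos_double_sin[of "x / 2"] by simp
  moreover have "(sin (x / 2))\<^sup>2 \<le> (x / 2)\<^sup>2"
    using abs_sin_x_le_abs_x[of "x / 2"] by (simp only: abs_le_square_iff)
  ultimately show ?thesis by (simp add: power2_eq_square)
qed

text \<open>
  As the inverse roots \<open>\<rho> exp (\<plusminus> \<i> \<gamma>)\<close> approach the unit circle, the normalized density
  concentrates at \<open>\<plusminus> \<gamma>\<close>.
\<close>

lemma F_AR2_concentrated: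
  fixes \<gamma> \<tau> :: real
  assumes "0 < \<gamma>" "\<gamma> \<le> 1" "0 < \<tau>"
  obtains f where "f \<in> F_AR2" "\<And>\<omega>. \<omega> \<in> {-pi..pi} \<Longrightarrow> 0 < f \<omega>"
    and "\<And>\<omega>. \<omega> \<in> {-pi..pi} \<Longrightarrow> \<not> (\<gamma> / 2 \<le> \<bar>\<omega>\<bar> \<and> \<bar>\<omega>\<bar> \<le> 2 * \<gamma>) \<Longrightarrow> f \<omega> \<le> \<tau>"
proof -
  define b where "b = 1 - cos (\<gamma> / 2)"
  have pi3: "3 < pi" by (rule pi_gt3)
  have "cos (\<gamma> / 2) < cos 0"
    using assms pi3 by (intro cos_monotone_0_pi) auto
  then have "0 < b" by (simp add: b_def)
  \<comment> \<open>Distance of the inverse roots from the unit circle. The bound 1/2 gives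
    \<open>2 * \<rho> \<ge> 1\<close>, so that \<open>q x\<close> is at least
    \<open>1 - cos x\<close>; the other bound makes the final estimate
    \<open>8 * \<epsilon> / b\<^sup>2\<close> at most \<tau>.\<close>
  define \<epsilon> where "\<epsilon> = min (1 / 2) (\<tau> * b\<^sup>2 / 8)"
  have \<epsilon>: "0 < \<epsilon>" "\<epsilon> \<le> 1 / 2" "8 * \<epsilon> \<le> \<tau> * b\<^sup>2"
    using \<open>0 < b\<close> \<open>0 < \<tau>\<close> by (auto simp: \<epsilon>_def min_def)
  define \<rho> where "\<rho> = 1 - \<epsilon>"
  define q where "q x = (1 - \<rho>)\<^sup>2 + 2 * \<rho> * (1 - cos x)" for x
  define D where "D = AR2_denominator (2 * \<rho> * cos \<gamma>) (- \<rho>\<^sup>2)"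
  have D: "D \<omega> = q (\<omega> - \<gamma>) * q (\<omega> + \<gamma>)" for \<omega>
    by (simp add: D_def AR2_denominator_polar q_def)
  have \<rho>: "1 / 2 \<le> \<rho>" "\<rho> \<le> 1" "1 - \<rho> = \<epsilon>" using \<epsilon> by (auto simp: \<rho>_def)
  have q_ge: "\<epsilon>\<^sup>2 \<le> q x" "1 - cos x \<le> q x" for x
  proof -
    have "0 \<le> (2 * \<rho> - 1) * (1 - cos x)" "0 \<le> 2 * \<rho> * (1 - cos x)"
      using \<rho> by (auto intro!: mult_nonneg_nonneg)
    moreover have "(2 * \<rho> - 1) * (1 - cos x) = 2 * \<rho> * (1 - cos x) - (1 - cos x)"
      by (simp add: algebra_simps)
    ultimately show "\<epsilon>\<^sup>2 \<le> q x" "1 - cos x \<le> q x"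
      using zero_le_power2[of \<epsilon>] unfolding q_def \<rho>(3) by linarith+
  qed
  have qpos: "0 < q x" for x using q_ge(1)[of x] \<epsilon>(1) by (smt (verit) zero_less_power)
  have Dpos: "0 < D \<omega>" for \<omega> using qpos by (simp add: D)
  have contD: "continuous_on A D" for A
    unfolding D_def AR2_denominator_def[abs_def] by (intro continuous_intros)
  have contI: "continuous_on A (\<lambda>\<omega>. 1 / D \<omega>)" for A
    by (intro continuous_intros contD) (use Dpos in \<open>auto simp: less_imp_neq[symmetric]\<close>)
  have D_lower: "b\<^sup>2 \<le> D \<omega>" if "\<omega> \<in> {-pi..pi}" "\<not> (\<gamma> / 2 \<le> \<bar>\<omega>\<bar> \<and> \<bar>\<omega>\<bar> \<le> 2 * \<gamma>)" for \<omega>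
  proof -
    \<comment> \<open>The range extends beyond pi since \<omega> shifted by \<gamma> may leave the
      interval; by periodicity only the distance to multiples of 2 pi matters.\<close>
    have b_le: "b \<le> q x" if x: "\<gamma> / 2 \<le> \<bar>x\<bar>" "\<bar>x\<bar> \<le> 2 * pi - \<gamma> / 2" for x
    proof -
      have "cos \<bar>x\<bar> \<le> cos (\<gamma> / 2)"
      proof (cases "\<bar>x\<bar> \<le> pi")
        case True
        then show ?thesis using x assms by (intro cos_monotone_0_pi_le) auto
      next
        case False
        then have "cos (2 * pi - \<bar>x\<bar>) \<le> cos (\<gamma> / 2)"
          using x assms by (intro cos_monotone_0_pi_le) auto
        then show ?thesis by (simp add: cos_diff)
      qed
      then show ?thesis using q_ge(2)[of x] by (simp add: b_def)
    qed
    have w: "- pi \<le> \<omega>" "\<omega> \<le> pi" "\<bar>\<omega>\<bar> < \<gamma> / 2 \<or> 2 * \<gamma> < \<bar>\<omega>\<bar>"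
      using that by auto
    have "\<gamma> / 2 \<le> \<bar>\<omega> - \<gamma>\<bar>" "\<bar>\<omega> - \<gamma>\<bar> \<le> 2 * pi - \<gamma> / 2"
      "\<gamma> / 2 \<le> \<bar>\<omega> + \<gamma>\<bar>" "\<bar>\<omega> + \<gamma>\<bar> \<le> 2 * pi - \<gamma> / 2"
      using w assms pi3 by (simp_all only: abs_if split: if_splits) linarith+
    then have "b \<le> q (\<omega> - \<gamma>)" "b \<le> q (\<omega> + \<gamma>)"
      by (auto intro!: b_le)
    then show ?thesis
      using \<open>0 < b\<close> by (simp add: D power2_eq_square mult_mono)
  qed
  \<comment> \<open>On an interval of length \<epsilon> at the peak the denominator is of order
    \<open>\<epsilon>\<^sup>2\<close>, so the integral of \<open>1 / D\<close> is at least
    \<open>1 / (8 * \<epsilon>)\<close> and the normalizing constant is at most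
    \<open>8 * \<epsilon>\<close>.\<close>
  have D_upper: "D \<omega> \<le> 8 * \<epsilon>\<^sup>2" if "\<omega> \<in> {\<gamma>..\<gamma> + \<epsilon>}" for \<omega>
  proof -
    have "q (\<omega> - \<gamma>) \<le> \<epsilon>\<^sup>2 + 2 * 1 * ((\<omega> - \<gamma>)\<^sup>2 / 2)"
      unfolding q_def \<rho>(3) using \<rho> one_minus_cos_le
      by (intro add_left_mono mult_mono) auto
    also have "(\<omega> - \<gamma>)\<^sup>2 \<le> \<epsilon>\<^sup>2"
      using that by (intro power_mono) auto
    finally have 1: "q (\<omega> - \<gamma>) \<le> 2 * \<epsilon>\<^sup>2" by simp
    have "q (\<omega> + \<gamma>) \<le> (1 - \<rho>)\<^sup>2 + 2 * \<rho> * 2"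
      unfolding q_def using \<rho> cos_ge_minus_one[of "\<omega> + \<gamma>"] by (intro add_left_mono mult_left_mono) auto
    also have "\<dots> = (1 + \<rho>)\<^sup>2" by (simp add: power2_eq_square algebra_simps)
    also have "\<dots> \<le> 2\<^sup>2" using \<rho> by (intro power_mono) auto
    finally have "q (\<omega> + \<gamma>) \<le> 4" by simp
    with 1 have "D \<omega> \<le> 2 * \<epsilon>\<^sup>2 * 4"
      unfolding D using qpos by (intro mult_mono) (auto simp: less_imp_le)
    then show ?thesis by simp
  qed
  define I where "I = integral {-pi..pi} (\<lambda>\<omega>. 1 / D \<omega>)"
  have int: "(\<lambda>\<omega>. 1 / D \<omega>) integrable_on {a..b}" for a b
    by (intro integrable_continuous_interval contI)
  have "1 / (8 * \<epsilon>) = integral {\<gamma>..\<gamma> + \<epsilon>} (\<lambda>\<omega>. 1 / (8 * \<epsilon>\<^sup>2))"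
    using \<epsilon> by (simp add: power2_eq_square)
  also have "\<dots> \<le> integral {\<gamma>..\<gamma> + \<epsilon>} (\<lambda>\<omega>. 1 / D \<omega>)"
    by (intro integral_le int) (use D_upper Dpos \<epsilon> in \<open>auto intro!: divide_left_mono\<close>)
  also have "\<dots> \<le> I"
    unfolding I_def using assms \<epsilon> pi3 Dpos by (intro integral_subset_le int) (auto simp: less_imp_le)
  finally have I: "1 / (8 * \<epsilon>) \<le> I" .
  then have "0 < I" using \<epsilon> by (smt (verit) divide_pos_pos)
  have c: "1 / I \<le> 8 * \<epsilon>" using I \<open>0 < I\<close> \<epsilon> by (simp add: field_simps)
  have 1: "integral {-pi..pi} (\<lambda>\<omega>. (1 / I) / D \<omega>) = 1"
  proof -
    have "integral {-pi..pi} (\<lambda>\<omega>. (1 / I) * (1 / D \<omega>)) = (1 / I) * I"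
      unfolding I_def by (rule integral_mult_right)
    then show ?thesis using \<open>0 < I\<close> by simp
  qed
  show thesis
  proof (rule that)
    show "restrict (\<lambda>\<omega>. (1 / I) / D \<omega>) {-pi..pi} \<in> F_AR2"
      unfolding D_def by (rule F_AR2_I) (use Dpos 1 \<open>0 < I\<close> in \<open>auto simp: D_def\<close>)
    show "0 < restrict (\<lambda>\<omega>. (1 / I) / D \<omega>) {-pi..pi} \<omega>" if "\<omega> \<in> {-pi..pi}" for \<omega>
      using that Dpos \<open>0 < I\<close> by simp
    fix \<omega> assume w: "\<omega> \<in> {-pi..pi}" "\<not> (\<gamma> / 2 \<le> \<bar>\<omega>\<bar> \<and> \<bar>\<omega>\<bar> \<le> 2 * \<gamma>)"
    have "(1 / I) / D \<omega> \<le> 8 * \<epsilon> / b\<^sup>2"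
      using c D_lower[OF w] \<open>0 < b\<close> \<open>0 < I\<close> \<epsilon> by (intro frac_le) auto
    also have "\<dots> \<le> \<tau>" using \<epsilon>(3) \<open>0 < b\<close> by (simp add: field_simps)
    finally show "restrict (\<lambda>\<omega>. (1 / I) / D \<omega>) {-pi..pi} \<omega> \<le> \<tau>" using w(1) by simp
  qed
qed

section \<open>Quadratic forms of \<open>Sigma_f\<close> in the frequency domain\<close>

definition periodogram :: "real^('n::{finite,linorder}) \<Rightarrow> real \<Rightarrow> real" where
  "periodogram v \<omega> = (cmod (\<Sum>j\<in>UNIV. of_real (v $ j) * iexp (real (pos j) * \<omega>)))\<^sup>2"

lemma periodogram_nonneg [simp]: "0 \<le> periodogram v \<omega>"
  by (simp add: periodogram_def)

text \<open>Expanding the squared modulus brings out the cosines that define the entries of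
  \<open>Sigma_f\<close>.\<close>

lemma periodogram_eq:
  "periodogram v \<omega> = (\<Sum>j\<in>UNIV. \<Sum>l\<in>UNIV. v $ j * v $ l * cos (of_int (int (pos j) - int (pos l)) * \<omega>))"
proof -
  let ?z = "\<Sum>j\<in>UNIV. of_real (v $ j) * iexp (real (pos j) * \<omega>)"
  have ReIm: "Re ?z = (\<Sum>j\<in>UNIV. v $ j * cos (real (pos j) * \<omega>))" "Im ?z = (\<Sum>j\<in>UNIV. v $ j * sin (real (pos j) * \<omega>))"
    by (simp_all add: Re_exp Im_exp)
  have "periodogram v \<omega> = (\<Sum>j\<in>UNIV. v $ j * cos (real (pos j) * \<omega>))\<^sup>2 + (\<Sum>j\<in>UNIV. v $ j * sin (real (pos j) * \<omega>))\<^sup>2"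
    unfolding periodogram_def cmod_power2 ReIm ..
  also have "\<dots> = (\<Sum>j\<in>UNIV. \<Sum>l\<in>UNIV. v $ j * v $ l * cos (real (pos j) * \<omega> - real (pos l) * \<omega>))"
    by (simp add: power2_eq_square sum_product cos_diff distrib_left sum.distrib mult_ac)
  finally show ?thesis by (simp add: left_diff_distrib)
qed

lemma continuous_on_periodogram: "continuous_on A (periodogram v)"
  unfolding periodogram_def[abs_def] by (intro continuous_intros)

lemma Sigma_f_component:
  fixes f :: "real \<Rightarrow> real"
  assumes "continuous_on {-pi..pi} f" "\<forall>\<omega>\<in>{-pi..pi}. f (- \<omega>) = f \<omega>"
  shows "Sigma_f f $ j $ l = integral {-pi..pi} (\<lambda>\<omega>. cos (of_int (int (pos j) - int (pos l)) * \<omega>) * f \<omega>)"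
proof -
  define h where "h = int (pos j) - int (pos l)"
  have "Sigma_f f $ j $ l = Re (integral {-pi..pi} (\<lambda>\<omega>. exp (- \<i> * of_int h * of_real \<omega>) * of_real (f \<omega>)))"
    by (simp only: Sigma_f_def vec_lambda_beta h_def)
  also have "\<dots> = Re (integral {-pi..pi} (\<lambda>\<omega>. exp (\<i> * of_int (- h) * of_real \<omega>) * of_real (f \<omega>)))"
    by simp
  also have "\<dots> = integral {-pi..pi} (\<lambda>\<omega>. cos (of_int (- h) * \<omega>) * f \<omega>)"
    by (simp only: integral_exp_mult_even[OF assms] Re_complex_of_real)
  also have "\<dots> = integral {-pi..pi} (\<lambda>\<omega>. cos (of_int h * \<omega>) * f \<omega>)"
    by simp
  finally show ?thesis unfolding h_def .
qed

lemma Sigma_f_quadratic: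
  fixes f :: "real \<Rightarrow> real" and v :: "real^('n::{finite,linorder})"
  assumes cont: "continuous_on {-pi..pi} f" and even: "\<forall>\<omega>\<in>{-pi..pi}. f (- \<omega>) = f \<omega>"
  shows "v \<bullet> (Sigma_f f *v v) = integral {-pi..pi} (\<lambda>\<omega>. periodogram v \<omega> * f \<omega>)"
proof -
  have "((\<lambda>\<omega>. \<Sum>j\<in>UNIV. \<Sum>l\<in>UNIV. v $ j * v $ l * (cos (of_int (int (pos j) - int (pos l)) * \<omega>) * f \<omega>))
      has_integral (\<Sum>j\<in>UNIV. \<Sum>l\<in>UNIV. v $ j * v $ l * Sigma_f f $ j $ l)) {-pi..pi}"
    unfolding Sigma_f_component[OF assms]
    by (intro has_integral_sum finite has_integral_mult_right integrable_integral
      integrable_continuous_interval continuous_intros cont)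
  moreover have "v \<bullet> (Sigma_f f *v v) = (\<Sum>j\<in>UNIV. \<Sum>l\<in>UNIV. v $ j * v $ l * Sigma_f f $ j $ l)"
    by (simp add: inner_vec_def matrix_vector_mult_def sum_distrib_left mult_ac)
  ultimately show ?thesis
    by (simp add: integral_unique periodogram_eq sum_distrib_right mult.assoc)
qed

lemma symmetric_Sigma_f: 
  fixes f :: "real \<Rightarrow> real"
  assumes "continuous_on {-pi..pi} f" "\<forall>\<omega>\<in>{-pi..pi}. f (- \<omega>) = f \<omega>"
  shows "symmetric_matrix (Sigma_f f :: real^('n::{finite,linorder})^('n::{finite,linorder}))"
proof -
  have "cos (of_int (int (pos j) - int (pos l)) * \<omega>) = cos (of_int (int (pos l) - int (pos j)) * \<omega>)"
    for j l :: 'n and \<omega> :: real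
    using cos_minus[of "of_int (int (pos j) - int (pos l)) * \<omega>"] by (simp add: algebra_simps)
  then have "Sigma_f f $ j $ l = Sigma_f f $ l $ j" for j l :: 'n
    unfolding Sigma_f_component[OF assms] by presburger
  then show ?thesis
    by (simp add: symmetric_matrix_def vec_eq_iff transpose_def)
qed

text \<open>Parseval's identity: distinct indices have distinct positions, so only diagonal terms
  survive.\<close>

lemma integral_periodogram: "integral {-pi..pi} (periodogram v) = 2 * pi * (v \<bullet> v)"
proof -
  have *: "((\<lambda>\<omega>. cos (of_int h * \<omega>)) has_integral (if h = 0 then 2 * pi else 0)) {-pi..pi}" for h :: int
    unfolding integral_cos_period[symmetric]
    by (intro integrable_integral integrable_continuous_interval continuous_intros)
  have "(periodogram v has_integral (\<Sum>j\<in>UNIV. \<Sum>l\<in>UNIV. v $ j * v $ l * (if int (pos j) - int (pos l) = 0 then 2 * pi else 0))) {-pi..pi}"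
    unfolding periodogram_eq[abs_def]
    by (intro has_integral_sum finite has_integral_mult_right *)
  moreover have "(\<Sum>j\<in>UNIV. \<Sum>l\<in>UNIV. v $ j * v $ l * (if int (pos j) - int (pos l) = 0 then 2 * pi else 0)) = 2 * pi * (v \<bullet> v)"
    by (simp add: pos_inject if_distrib inner_vec_def sum_distrib_left mult_ac cong: if_cong)
  ultimately show ?thesis by (simp add: integral_unique)
qed

text \<open>A continuous positive density is bounded below by its positive minimum, and for a
  constant density Parseval's identity gives the form exactly.\<close>

lemma Sigma_f_pos_def:
  fixes f :: "real \<Rightarrow> real"
  assumes cont: "continuous_on {-pi..pi} f" and even: "\<forall>\<omega>\<in>{-pi..pi}. f (- \<omega>) = f \<omega>"
    and pos: "\<And>\<omega>. \<omega> \<in> {-pi..pi} \<Longrightarrow> 0 < f \<omega>" and "v \<noteq> 0"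
  shows "0 < v \<bullet> (Sigma_f f *v v)"
proof -
  obtain x where x: "x \<in> {-pi..pi}" "\<And>\<omega>. \<omega> \<in> {-pi..pi} \<Longrightarrow> f x \<le> f \<omega>"
    using continuous_attains_inf[OF _ _ cont] by auto
  have "0 < f x * (2 * pi * (v \<bullet> v))"
    using pos[OF x(1)] \<open>v \<noteq> 0\<close> by simp
  also have "\<dots> = integral {-pi..pi} (\<lambda>\<omega>. periodogram v \<omega> * f x)"
    by (simp add: integral_periodogram)
  also have "\<dots> \<le> integral {-pi..pi} (\<lambda>\<omega>. periodogram v \<omega> * f \<omega>)"
    by (intro integral_le integrable_continuous_interval continuous_intros cont continuous_on_periodogram mult_left_mono x) auto
  finally show ?thesis
    by (simp add: Sigma_f_quadratic[OF cont even])
qed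

section \<open>Spectral mass near frequency zero\<close>

text \<open>The pairing of \<open>v\<close> with the trend of degree \<open>k\<close>; up to a power
  of the imaginary unit, the \<open>k\<close>-th derivative at frequency zero of the trigonometric
  polynomial behind \<open>periodogram\<close>.\<close>

definition moment :: "real^('n::{finite,linorder}) \<Rightarrow> nat \<Rightarrow> real" where
  "moment v k = (\<Sum>j\<in>UNIV. v $ j * real (pos j) ^ k)"

text \<open>Taylor expansion of each exponential at zero; interchanging the sums makes the moments
  the coefficients. The factorial in the remainder is dropped.\<close>

lemma moment_expansion:
  "cmod ((\<Sum>j\<in>UNIV. of_real (v $ j) * iexp (real (pos j) * \<omega>)) - (\<Sum>k\<le>n. (\<i> * of_real \<omega>) ^ k / fact k * of_real (moment v k)))
    \<le> (\<Sum>j\<in>UNIV. \<bar>v $ j\<bar> * real (pos j) ^ Suc n) * \<bar>\<omega>\<bar> ^ Suc n"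
proof -
  let ?r = "\<lambda>j. iexp (real (pos j) * \<omega>) - (\<Sum>k\<le>n. (\<i> * of_real (real (pos j) * \<omega>)) ^ k / fact k)"
  have r: "cmod (?r j) \<le> real (pos j) ^ Suc n * \<bar>\<omega>\<bar> ^ Suc n" for j :: 'a
  proof -
    have "cmod (?r j) \<le> \<bar>real (pos j) * \<omega>\<bar> ^ Suc n / fact (Suc n)"
      using iexp_approx1[of "real (pos j) * \<omega>" n] by simp
    also have "\<dots> \<le> \<bar>real (pos j) * \<omega>\<bar> ^ Suc n / 1"
      by (intro divide_left_mono) (auto simp del: fact_Suc)
    finally show ?thesis by (simp add: abs_mult power_mult_distrib mult_ac)
  qed
  have "(\<Sum>k\<le>n. (\<i> * of_real \<omega>) ^ k / fact k * of_real (moment v k))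
      = (\<Sum>j\<in>UNIV. of_real (v $ j) * (\<Sum>k\<le>n. (\<i> * of_real (real (pos j) * \<omega>)) ^ k / fact k))"
    unfolding moment_def of_real_sum sum_distrib_left
    by (subst sum.swap) (simp add: power_mult_distrib mult_ac)
  then have "(\<Sum>j\<in>UNIV. of_real (v $ j) * iexp (real (pos j) * \<omega>)) - (\<Sum>k\<le>n. (\<i> * of_real \<omega>) ^ k / fact k * of_real (moment v k))
     = (\<Sum>j\<in>UNIV. of_real (v $ j) * ?r j)"
    by (simp add: right_diff_distrib sum_subtractf)
  also have "cmod \<dots> \<le> (\<Sum>j\<in>UNIV. \<bar>v $ j\<bar> * (real (pos j) ^ Suc n * \<bar>\<omega>\<bar> ^ Suc n))"
    by (intro sum_norm_le) (use r in \<open>simp add: norm_mult mult_left_mono del: power_Suc\<close>)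
  finally show ?thesis
    by (simp add: sum_distrib_right mult.assoc)
qed

text \<open>The vanishing moments remove the Taylor polynomial of degree \<open>p - 1\<close>, so
  only the remainder is left.\<close>

lemma periodogram_upper:
  assumes "1 \<le> p" "\<And>k. k < p \<Longrightarrow> moment v k = 0"
  obtains K where "0 \<le> K" "\<And>\<omega>. periodogram v \<omega> \<le> K * \<omega> ^ (2 * p)"
proof
  let ?K = "\<Sum>j\<in>UNIV. \<bar>v $ j\<bar> * real (pos j) ^ p"
  obtain n where n: "p = Suc n" using \<open>1 \<le> p\<close> by (cases p) auto
  show "0 \<le> ?K\<^sup>2" by simp
  fix \<omega>
  have "(\<Sum>k\<le>n. (\<i> * complex_of_real \<omega>) ^ k / fact k * of_real (moment v k)) = 0"
    using assms(2) n by (intro sum.neutral) auto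
  then have "cmod (\<Sum>j\<in>UNIV. of_real (v $ j) * iexp (real (pos j) * \<omega>)) \<le> ?K * \<bar>\<omega>\<bar> ^ p"
    using moment_expansion[of v \<omega> n] by (simp add: n del: power_Suc)
  then have "periodogram v \<omega> \<le> (?K * \<bar>\<omega>\<bar> ^ p)\<^sup>2"
    unfolding periodogram_def by (intro power_mono) auto
  also have "\<dots> = ?K\<^sup>2 * \<omega> ^ (2 * p)"
    by (simp add: power_mult_distrib power_even_eq flip: power_abs)
  finally show "periodogram v \<omega> \<le> ?K\<^sup>2 * \<omega> ^ (2 * p)" .
qed

text \<open>The first nonvanishing moment gives the leading Taylor term, which dominates the
  remainder near zero.\<close>

lemma periodogram_lower:
  assumes "\<And>k. k < d \<Longrightarrow> moment v k = 0" "moment v d \<noteq> 0"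
  obtains \<kappa> \<delta> where "0 < \<kappa>" "0 < \<delta>" "\<And>\<omega>. \<bar>\<omega>\<bar> \<le> \<delta> \<Longrightarrow> \<kappa> * \<omega> ^ (2 * d) \<le> periodogram v \<omega>"
proof
  let ?K = "\<Sum>j\<in>UNIV. \<bar>v $ j\<bar> * real (pos j) ^ Suc d"
  \<comment> \<open>Half of the modulus of the leading coefficient; the neighbourhood is chosen so
    that the remainder consumes at most the other half.\<close>
  define a where "a = \<bar>moment v d\<bar> / (2 * fact d)"
  have "0 < a" using assms(2) by (simp add: a_def)
  have "0 \<le> ?K" by (intro sum_nonneg) auto
  show "0 < a\<^sup>2" "0 < a / (?K + 1)" using \<open>0 < a\<close> \<open>0 \<le> ?K\<close> by auto
  fix \<omega> assume w: "\<bar>\<omega>\<bar> \<le> a / (?K + 1)"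
  let ?S = "\<Sum>j\<in>UNIV. of_real (v $ j) * iexp (real (pos j) * \<omega>)"
  let ?m = "(\<i> * complex_of_real \<omega>) ^ d / fact d * of_real (moment v d)"
  have "(\<Sum>k\<le>d. (\<i> * complex_of_real \<omega>) ^ k / fact k * of_real (moment v k)) = ?m"
    using assms(1) by (subst sum.remove[of _ d]) (auto intro!: sum.neutral)
  then have "cmod (?S - ?m) \<le> ?K * \<bar>\<omega>\<bar> ^ Suc d"
    using moment_expansion[of v \<omega> d] by simp
  also have "\<dots> = (?K * \<bar>\<omega>\<bar>) * \<bar>\<omega>\<bar> ^ d" by simp
  also have "?K * \<bar>\<omega>\<bar> \<le> (?K + 1) * (a / (?K + 1))"
    using w \<open>0 \<le> ?K\<close> by (intro mult_mono) auto
  also have "(?K + 1) * (a / (?K + 1)) = a" using \<open>0 \<le> ?K\<close> by simp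
  finally have 1: "cmod (?S - ?m) \<le> a * \<bar>\<omega>\<bar> ^ d" by (simp add: mult_right_mono)
  have "cmod ?m = 2 * a * \<bar>\<omega>\<bar> ^ d"
    by (simp add: norm_mult norm_divide norm_power a_def)
  moreover have "cmod ?m \<le> cmod ?S + cmod (?S - ?m)"
    using norm_triangle_sub[of ?m ?S] unfolding norm_minus_commute[of ?m ?S] .
  ultimately have "a * \<bar>\<omega>\<bar> ^ d \<le> cmod ?S" using 1 by linarith
  then have "(a * \<bar>\<omega>\<bar> ^ d)\<^sup>2 \<le> periodogram v \<omega>"
    unfolding periodogram_def using \<open>0 < a\<close> by (intro power_mono) auto
  moreover have "(a * \<bar>\<omega>\<bar> ^ d)\<^sup>2 = a\<^sup>2 * \<omega> ^ (2 * d)"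
    by (simp add: power_mult_distrib power_even_eq flip: power_abs)
  ultimately show "a\<^sup>2 * \<omega> ^ (2 * d) \<le> periodogram v \<omega>" by simp
qed

text \<open>For densities concentrated near plus or minus \<open>\<gamma> m\<close>, the numerator
  is of order at most \<open>\<gamma> m ^ (2 * p)\<close>, while the denominator is at least of
  order \<open>\<gamma> m ^ (2 * d)\<close>.\<close>

lemma F_AR2_sequence:
  fixes H :: "real^('n::{finite,linorder})^'q" and P :: "real^('n::{finite,linorder})^'p"
  assumes P: "\<And>j k. k < p \<Longrightarrow> moment (P $ j) k = 0"
    and H: "\<And>k. k < d \<Longrightarrow> moment (H $ a) k = 0" "moment (H $ a) d \<noteq> 0"
    and "d < p"
  obtains f where "\<And>m :: nat. f m \<in> F_AR2" "\<And>m \<omega>. \<omega> \<in> {-pi..pi} \<Longrightarrow> 0 < f m \<omega>"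
    and "(\<lambda>m. (\<Sum>j\<in>UNIV. P $ j \<bullet> (Sigma_f (f m) *v P $ j)) / (\<Sum>a\<in>UNIV. H $ a \<bullet> (Sigma_f (f m) *v H $ a))) \<longlonglongrightarrow> 0"
proof -
  have "\<exists>K. \<forall>j. 0 \<le> K j \<and> (\<forall>\<omega>. periodogram (P $ j) \<omega> \<le> K j * \<omega> ^ (2 * p))"
  proof (intro choice allI)
    fix j
    obtain K where "0 \<le> K" "\<And>\<omega>. periodogram (P $ j) \<omega> \<le> K * \<omega> ^ (2 * p)"
      by (rule periodogram_upper[of p "P $ j"]) (use P \<open>d < p\<close> in auto)
    then show "\<exists>K. 0 \<le> K \<and> (\<forall>\<omega>. periodogram (P $ j) \<omega> \<le> K * \<omega> ^ (2 * p))"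
      by blast
  qed
  then obtain K where K: "\<And>j. 0 \<le> K j" "\<And>j \<omega>. periodogram (P $ j) \<omega> \<le> K j * \<omega> ^ (2 * p)"
    by blast
  obtain \<kappa> \<delta> where \<kappa>: "0 < \<kappa>" "0 < \<delta>" "\<And>\<omega>. \<bar>\<omega>\<bar> \<le> \<delta> \<Longrightarrow> \<kappa> * \<omega> ^ (2 * d) \<le> periodogram (H $ a) \<omega>"
    using periodogram_lower[OF H] by blast
  \<comment> \<open>The denominator is at least 2, so the whole band up to
    \<open>2 * \<gamma> m\<close> lies where the lower bound on the periodogram holds.\<close>
  define \<gamma> where "\<gamma> m = min 1 \<delta> / real (m + 2)" for m
  have \<gamma>: "0 < \<gamma> m" "\<gamma> m \<le> 1" "2 * \<gamma> m \<le> \<delta>" for m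
  proof -
    show "0 < \<gamma> m" using \<kappa> by (simp add: \<gamma>_def)
    have "\<gamma> m \<le> min 1 \<delta> / 2" unfolding \<gamma>_def using \<kappa> by (intro divide_left_mono) auto
    then show "\<gamma> m \<le> 1" "2 * \<gamma> m \<le> \<delta>" by auto
  qed
  have \<gamma>0: "\<gamma> \<longlonglongrightarrow> 0"
    unfolding \<gamma>_def by real_asymp
  \<comment> \<open>Small enough that the off-band part of the numerator has the same order as the
    band part and that the off-band mass, at most \<open>2 * pi * \<tau> m\<close>, does not exceed
    1/2.\<close>
  define \<tau> where "\<tau> m = \<gamma> m ^ (2 * p) / (4 * pi)" for m
  have \<tau>: "0 < \<tau> m" for m using \<gamma> by (simp add: \<tau>_def)
  have "\<exists>f. \<forall>m. f m \<in> F_AR2 \<and> (\<forall>\<omega>\<in>{-pi..pi}. 0 < f m \<omega>) \<and>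
      (\<forall>\<omega>\<in>{-pi..pi}. \<not> (\<gamma> m / 2 \<le> \<bar>\<omega>\<bar> \<and> \<bar>\<omega>\<bar> \<le> 2 * \<gamma> m) \<longrightarrow> f m \<omega> \<le> \<tau> m)"
  proof (intro choice allI)
    fix m
    obtain f where "f \<in> F_AR2" "\<And>\<omega>. \<omega> \<in> {-pi..pi} \<Longrightarrow> 0 < f \<omega>"
      "\<And>\<omega>. \<omega> \<in> {-pi..pi} \<Longrightarrow> \<not> (\<gamma> m / 2 \<le> \<bar>\<omega>\<bar> \<and> \<bar>\<omega>\<bar> \<le> 2 * \<gamma> m) \<Longrightarrow> f \<omega> \<le> \<tau> m"
      using F_AR2_concentrated[OF \<gamma>(1,2) \<tau>, of m m] by blast
    then show "\<exists>f. f \<in> F_AR2 \<and> (\<forall>\<omega>\<in>{-pi..pi}. 0 < f \<omega>) \<and>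
      (\<forall>\<omega>\<in>{-pi..pi}. \<not> (\<gamma> m / 2 \<le> \<bar>\<omega>\<bar> \<and> \<bar>\<omega>\<bar> \<le> 2 * \<gamma> m) \<longrightarrow> f \<omega> \<le> \<tau> m)"
      by blast
  qed
  then obtain f where f: "\<And>m. f m \<in> F_AR2" "\<And>m \<omega>. \<omega> \<in> {-pi..pi} \<Longrightarrow> 0 < f m \<omega>"
    and off: "\<And>m \<omega>. \<omega> \<in> {-pi..pi} \<Longrightarrow> \<not> (\<gamma> m / 2 \<le> \<bar>\<omega>\<bar> \<and> \<bar>\<omega>\<bar> \<le> 2 * \<gamma> m) \<Longrightarrow> f m \<omega> \<le> \<tau> m"
    by blast
  have cont: "continuous_on {-pi..pi} (f m)" and even: "\<forall>\<omega>\<in>{-pi..pi}. f m (- \<omega>) = f m \<omega>"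
    and f1: "integral {-pi..pi} (f m) = 1" for m
    using f(1)[of m] by (auto simp: F_AR2_def F_all_def)
  have int_per: "(\<lambda>\<omega>. periodogram v \<omega> * f m \<omega>) integrable_on {-pi..pi}" for v :: "real^('n::{finite,linorder})" and m
    by (intro integrable_continuous_interval continuous_intros cont continuous_on_periodogram)
  \<comment> \<open>Both estimates compare the integrand with an affine function of the density,
    whose integral is explicit because the density has total mass 1.\<close>
  have int_aff: "((\<lambda>\<omega>. u * f m \<omega> + w) has_integral (u + 2 * pi * w)) {-pi..pi}" for u w m
  proof -
    have 1: "((\<lambda>\<omega>. u * f m \<omega>) has_integral u * 1) {-pi..pi}"
      using f1[of m] cont by (intro has_integral_mult_right) (metis integrable_continuous_interval integrable_integral)
    have 2: "((\<lambda>\<omega>. w) has_integral (2 * pi * w)) {-pi..pi}"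
      using has_integral_const_real[of w "-pi" pi] by simp
    show ?thesis using has_integral_add[OF 1 2] by simp
  qed
  have quad_nonneg: "0 \<le> v \<bullet> (Sigma_f (f m) *v v)" for v :: "real^('n::{finite,linorder})" and m
    using f(2) by (subst Sigma_f_quadratic[OF cont even])
      (auto intro!: integral_nonneg int_per mult_nonneg_nonneg simp: less_imp_le)
  have upper: "P $ j \<bullet> (Sigma_f (f m) *v P $ j) \<le> K j * ((4 ^ p + pi ^ (2 * p) / 2) * \<gamma> m ^ (2 * p))" for j m
  proof -
    have "P $ j \<bullet> (Sigma_f (f m) *v P $ j) \<le> K j * (2 * \<gamma> m) ^ (2 * p) + 2 * pi * (K j * pi ^ (2 * p) * \<tau> m)"
      unfolding Sigma_f_quadratic[OF cont even]
    proof (rule integral_le[OF int_per has_integral_integrable[OF int_aff],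
          of _ _ "K j * (2 * \<gamma> m) ^ (2 * p)" m "K j * pi ^ (2 * p) * \<tau> m", unfolded integral_unique[OF int_aff]])
      fix \<omega> assume w: "\<omega> \<in> {-pi..pi}"
      have le: "periodogram (P $ j) \<omega> * f m \<omega> \<le> K j * \<bar>\<omega>\<bar> ^ (2 * p) * f m \<omega>"
        using K(2)[of j \<omega>] f(2)[OF w, of m] by (intro mult_right_mono) (auto simp: power_even_abs)
      show "periodogram (P $ j) \<omega> * f m \<omega> \<le> K j * (2 * \<gamma> m) ^ (2 * p) * f m \<omega> + K j * pi ^ (2 * p) * \<tau> m"
      proof (cases "\<gamma> m / 2 \<le> \<bar>\<omega>\<bar> \<and> \<bar>\<omega>\<bar> \<le> 2 * \<gamma> m")
        case True
        then have "K j * \<bar>\<omega>\<bar> ^ (2 * p) * f m \<omega> \<le> K j * (2 * \<gamma> m) ^ (2 * p) * f m \<omega>"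
          using K(1)[of j] f(2)[OF w, of m] by (intro mult_right_mono mult_left_mono power_mono) auto
        moreover have "0 \<le> K j * pi ^ (2 * p) * \<tau> m" using K(1) \<tau>[of m] by simp
        ultimately show ?thesis using le by linarith
      next
        case False
        have "K j * \<bar>\<omega>\<bar> ^ (2 * p) * f m \<omega> \<le> K j * pi ^ (2 * p) * \<tau> m"
          using K(1)[of j] f(2)[OF w, of m] off[OF w False] w by (intro mult_mono mult_left_mono power_mono) auto
        moreover have "0 \<le> K j * (2 * \<gamma> m) ^ (2 * p) * f m \<omega>" using K(1) f(2)[OF w, of m] \<gamma>(1)[of m] by simp
        ultimately show ?thesis using le by linarith
      qed
    qed
    also have "\<dots> = K j * ((4 ^ p + pi ^ (2 * p) / 2) * \<gamma> m ^ (2 * p))"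
    proof -
      have "(2 * \<gamma> m) ^ (2 * p) = 4 ^ p * \<gamma> m ^ (2 * p)" by (simp add: power_mult_distrib power_mult)
      then show ?thesis by (simp add: \<tau>_def field_simps)
    qed
    finally show ?thesis .
  qed
  have lower: "\<kappa> * \<gamma> m ^ (2 * d) / (2 * 4 ^ d) \<le> H $ a \<bullet> (Sigma_f (f m) *v H $ a)" for m
  proof -
    \<comment> \<open>The comparison function lies below the integrand on the band by the
      periodogram bound; off the band it is nonpositive since the density is at most
      \<open>\<tau> m\<close>.\<close>
    have "\<kappa> * (\<gamma> m / 2) ^ (2 * d) + 2 * pi * (- (\<kappa> * (\<gamma> m / 2) ^ (2 * d) * \<tau> m)) \<le> H $ a \<bullet> (Sigma_f (f m) *v H $ a)"
      unfolding Sigma_f_quadratic[OF cont even]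
    proof (rule integral_le[OF has_integral_integrable[OF int_aff] int_per,
          of "\<kappa> * (\<gamma> m / 2) ^ (2 * d)" m "- (\<kappa> * (\<gamma> m / 2) ^ (2 * d) * \<tau> m)", unfolded integral_unique[OF int_aff]])
      fix \<omega> assume w: "\<omega> \<in> {-pi..pi}"
      show "\<kappa> * (\<gamma> m / 2) ^ (2 * d) * f m \<omega> + - (\<kappa> * (\<gamma> m / 2) ^ (2 * d) * \<tau> m) \<le> periodogram (H $ a) \<omega> * f m \<omega>"
      proof (cases "\<gamma> m / 2 \<le> \<bar>\<omega>\<bar> \<and> \<bar>\<omega>\<bar> \<le> 2 * \<gamma> m")
        case True
        then have "\<kappa> * (\<gamma> m / 2) ^ (2 * d) \<le> \<kappa> * \<bar>\<omega>\<bar> ^ (2 * d)"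
          using \<kappa>(1) \<gamma>(1)[of m] by (intro mult_left_mono power_mono) auto
        also have "\<dots> \<le> periodogram (H $ a) \<omega>"
          using \<kappa>(3)[of \<omega>] True \<gamma>(3)[of m] by (simp add: power_even_abs)
        finally have "\<kappa> * (\<gamma> m / 2) ^ (2 * d) * f m \<omega> \<le> periodogram (H $ a) \<omega> * f m \<omega>"
          using f(2)[OF w, of m] by (intro mult_right_mono) auto
        moreover have "0 \<le> \<kappa> * (\<gamma> m / 2) ^ (2 * d) * \<tau> m" using \<kappa>(1) \<gamma>(1)[of m] \<tau>[of m] by simp
        ultimately show ?thesis by linarith
      next
        case False
        have "\<kappa> * (\<gamma> m / 2) ^ (2 * d) * f m \<omega> \<le> \<kappa> * (\<gamma> m / 2) ^ (2 * d) * \<tau> m"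
          using off[OF w False] \<kappa>(1) \<gamma>(1)[of m] by (intro mult_left_mono) auto
        moreover have "0 \<le> periodogram (H $ a) \<omega> * f m \<omega>" using f(2)[OF w, of m] by simp
        ultimately show ?thesis by linarith
      qed
    qed
    moreover have "2 * pi * \<tau> m \<le> 1 / 2"
      using \<gamma>(1,2)[of m] by (simp add: \<tau>_def power_le_one)
    then have "\<kappa> * (\<gamma> m / 2) ^ (2 * d) * (1 / 2) \<le> \<kappa> * (\<gamma> m / 2) ^ (2 * d) * (1 - 2 * pi * \<tau> m)"
      using \<kappa>(1) \<gamma>(1)[of m] by (intro mult_left_mono) auto
    moreover have "(\<gamma> m / 2) ^ (2 * d) = \<gamma> m ^ (2 * d) / 4 ^ d"
      by (simp add: power_divide power_mult)
    ultimately show ?thesis by (simp add: algebra_simps)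
  qed
  define C where "C = (\<Sum>j\<in>UNIV. K j) * (4 ^ p + pi ^ (2 * p) / 2) * (2 * 4 ^ d) / \<kappa>"
  have "(\<lambda>m. (\<Sum>j\<in>UNIV. P $ j \<bullet> (Sigma_f (f m) *v P $ j)) / (\<Sum>a\<in>UNIV. H $ a \<bullet> (Sigma_f (f m) *v H $ a))) \<longlonglongrightarrow> 0"
  proof (rule tendsto_sandwich[OF _ _ tendsto_const])
    show "(\<lambda>m. C * \<gamma> m) \<longlonglongrightarrow> 0"
      using tendsto_mult_left[OF \<gamma>0, of C] by simp
    show "\<forall>\<^sub>F m in sequentially. 0 \<le> (\<Sum>j\<in>UNIV. P $ j \<bullet> (Sigma_f (f m) *v P $ j)) / (\<Sum>a\<in>UNIV. H $ a \<bullet> (Sigma_f (f m) *v H $ a))"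
      by (intro always_eventually allI divide_nonneg_nonneg sum_nonneg quad_nonneg)
    show "\<forall>\<^sub>F m in sequentially. (\<Sum>j\<in>UNIV. P $ j \<bullet> (Sigma_f (f m) *v P $ j)) / (\<Sum>a\<in>UNIV. H $ a \<bullet> (Sigma_f (f m) *v H $ a)) \<le> C * \<gamma> m"
    proof (intro always_eventually allI)
      fix m
      have "H $ a \<bullet> (Sigma_f (f m) *v H $ a) \<le> (\<Sum>a\<in>UNIV. H $ a \<bullet> (Sigma_f (f m) *v H $ a))"
        by (intro member_le_sum quad_nonneg) auto
      with lower[of m] have low: "\<kappa> * \<gamma> m ^ (2 * d) / (2 * 4 ^ d) \<le> (\<Sum>a\<in>UNIV. H $ a \<bullet> (Sigma_f (f m) *v H $ a))"
        by linarith
      have "(\<Sum>j\<in>UNIV. P $ j \<bullet> (Sigma_f (f m) *v P $ j)) \<le> (\<Sum>j\<in>UNIV. K j) * ((4 ^ p + pi ^ (2 * p) / 2) * \<gamma> m ^ (2 * p))"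
        unfolding sum_distrib_right by (intro sum_mono upper)
      then have "(\<Sum>j\<in>UNIV. P $ j \<bullet> (Sigma_f (f m) *v P $ j)) / (\<Sum>a\<in>UNIV. H $ a \<bullet> (Sigma_f (f m) *v H $ a))
        \<le> (\<Sum>j\<in>UNIV. K j) * ((4 ^ p + pi ^ (2 * p) / 2) * \<gamma> m ^ (2 * p)) / (\<kappa> * \<gamma> m ^ (2 * d) / (2 * 4 ^ d))"
        using low \<kappa>(1) \<gamma>(1)[of m] K(1)
        by (intro frac_le) (auto intro!: mult_nonneg_nonneg sum_nonneg add_nonneg_nonneg simp: less_imp_le)
      also have "\<dots> = C * \<gamma> m ^ (2 * p - 2 * d)"
        using \<gamma>(1)[of m] \<open>d < p\<close> by (simp add: C_def power_diff field_simps)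
      \<comment> \<open>The exponent is at least 2 and \<open>\<gamma> m\<close> is at most 1, so
        the first power is a valid bound.\<close>
      also have "\<dots> \<le> C * \<gamma> m ^ 1"
      proof (rule mult_left_mono)
        show "\<gamma> m ^ (2 * p - 2 * d) \<le> \<gamma> m ^ 1"
          using \<gamma>(1,2)[of m] \<open>d < p\<close> by (intro power_decreasing) auto
        show "0 \<le> C"
          unfolding C_def using K(1) \<kappa>(1) by (intro divide_nonneg_pos mult_nonneg_nonneg sum_nonneg) auto
      qed
      finally show "(\<Sum>j\<in>UNIV. P $ j \<bullet> (Sigma_f (f m) *v P $ j)) / (\<Sum>a\<in>UNIV. H $ a \<bullet> (Sigma_f (f m) *v H $ a)) \<le> C * \<gamma> m"
        by simp
    qed
  qed
  with f that show thesis by blast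
qed

section \<open>Least squares and the test statistic\<close>

context
  fixes X :: "real^('k::{finite,linorder})^('n::{finite,linorder})"
  assumes rank_X: "rank X = CARD('k)"
begin

lemma gram_pos_def:
  assumes "x \<noteq> 0"
  shows "0 < x \<bullet> ((transpose X ** X) *v x)"
proof -
  have "X *v x \<noteq> 0"
    using assms rank_X full_rank_injective[of X] by (metis injD matrix_vector_mult_0_right)
  moreover have "x \<bullet> ((transpose X ** X) *v x) = (X *v x) \<bullet> (X *v x)"
    using inner_matrix_transpose[of x "transpose X" "X *v x"]
    by (simp only: transpose_transpose matrix_vector_mul_assoc)
  ultimately show ?thesis by simp
qed

lemma gram_invertible: "invertible (transpose X ** X)"
  by (rule pos_def_invertible) (rule gram_pos_def)

lemma symmetric_gram: "symmetric_matrix (transpose X ** X)"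
  by (simp add: symmetric_matrix_def matrix_transpose_mul transpose_transpose)

lemma ols_matrix: "ols X y = (matrix_inv (transpose X ** X) ** transpose X) *v y"
  by (simp add: ols_def flip: matrix_vector_mul_assoc)

lemma ols_range: "ols X (X *v \<eta>) = \<eta>"
  unfolding ols_def by (simp add: matrix_vector_mul_assoc matrix_inv_left[OF gram_invertible] flip: matrix_mul_assoc)

lemma ols_affine: "ols X (\<delta> *\<^sub>R y + X *v \<eta>) = \<delta> *\<^sub>R ols X y + \<eta>"
  using ols_range[of \<eta>] unfolding ols_matrix by (simp add: matrix_vector_right_distrib matrix_vector_mult_scaleR)

lemma residual_affine: "residual X (\<delta> *\<^sub>R y + X *v \<eta>) = \<delta> *\<^sub>R residual X y"
  unfolding residual_def ols_affine
  by (simp add: matrix_vector_right_distrib matrix_vector_mult_scaleR scaleR_diff_right)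

lemma linear_residual: "linear (residual X)"
  by (rule linearI)
    (simp_all add: residual_def ols_matrix matrix_vector_right_distrib matrix_vector_mult_scaleR scaleR_diff_right)

text \<open>The normal equations.\<close>

lemma range_orthogonal_residual: "(X *v \<beta>) \<bullet> residual X y = 0"
proof -
  have "transpose X *v residual X y = transpose X *v y - ((transpose X ** X) ** matrix_inv (transpose X ** X)) *v (transpose X *v y)"
    by (simp add: residual_def ols_def matrix_vector_mult_diff_distrib matrix_vector_mul_assoc matrix_mul_assoc)
  then have "transpose X *v residual X y = 0"
    by (simp add: matrix_inv_right[OF gram_invertible])
  then show ?thesis
    using inner_matrix_transpose[of \<beta> "transpose X" "residual X y"] by (simp add: transpose_transpose)
qed

lemma residual_in_orthogonal_comp: "residual X y \<in> orthogonal_comp (colspan X)"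
proof -
  have "columns X \<subseteq> {w. orthogonal w (residual X y)}"
  proof
    fix w assume "w \<in> columns X"
    then obtain i where "w = X *v axis i 1"
      by (auto simp: columns_def matrix_vector_axis)
    then show "w \<in> {w. orthogonal w (residual X y)}"
      by (simp add: orthogonal_def range_orthogonal_residual)
  qed
  moreover have "subspace {w. orthogonal w (residual X y)}"
    by (auto simp: subspace_def orthogonal_def inner_left_distrib)
  ultimately have "span (columns X) \<subseteq> {w. orthogonal w (residual X y)}"
    by (rule span_minimal)
  then show ?thesis
    by (auto simp: orthogonal_comp_def colspan_def)
qed

text \<open>The residual meets the description under \<open>THE\<close>; for uniqueness, the
  difference of two candidates is orthogonal to itself.\<close>

lemma projection_matrix_residual:
  "projection_matrix (orthogonal_comp (colspan X)) *v y = residual X y"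
proof -
  have "(THE z. z \<in> orthogonal_comp (colspan X) \<and> (\<forall>w\<in>orthogonal_comp (colspan X). orthogonal (y - z) w)) = residual X y"
    for y
  proof (rule the_equality)
    have "orthogonal (y - residual X y) w" if "w \<in> orthogonal_comp (colspan X)" for w
      using that matrix_vector_mult_in_columnspace[of X "ols X y"]
      by (simp add: residual_def orthogonal_comp_def colspan_def)
    then show "residual X y \<in> orthogonal_comp (colspan X) \<and>
        (\<forall>w\<in>orthogonal_comp (colspan X). orthogonal (y - residual X y) w)"
      using residual_in_orthogonal_comp by blast
    fix z assume z: "z \<in> orthogonal_comp (colspan X) \<and> (\<forall>w\<in>orthogonal_comp (colspan X). orthogonal (y - z) w)"
    have "z - residual X y \<in> orthogonal_comp (colspan X)"
      using z residual_in_orthogonal_comp subspace_orthogonal_comp by (blast intro: subspace_diff)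
    then have "orthogonal (y - z) (z - residual X y)" "orthogonal (y - residual X y) (z - residual X y)"
      using z \<open>\<And>w. w \<in> orthogonal_comp (colspan X) \<Longrightarrow> orthogonal (y - residual X y) w\<close> by blast+
    then have "(z - residual X y) \<bullet> (z - residual X y) = 0"
      by (simp add: orthogonal_def inner_diff_left)
    then show "z = residual X y" by simp
  qed
  then show ?thesis
    unfolding projection_matrix_def using linear_residual by (simp add: matrix_works linear_matrix_vector_mul_eq)
qed

lemma residual_inner_swap: "residual X x \<bullet> y = x \<bullet> residual X y"
proof -
  have "residual X x \<bullet> y = residual X x \<bullet> residual X y"
    using range_orthogonal_residual[of "ols X y" x]
    by (simp add: residual_def[of X y] inner_diff_right inner_commute)
  also have "\<dots> = x \<bullet> residual X y"
    using range_orthogonal_residual[of "ols X x" y] by (simp add: residual_def[of X x] inner_diff_left)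
  finally show ?thesis .
qed

text \<open>Self-adjointness of the residual map moves both projections onto \<open>W\<close>, which
  produces the matrix assumed to be nonzero and nonnegative definite.\<close>

lemma omega_W_quadratic:
  "omega_W W X y = (y \<bullet> ((projection_matrix (orthogonal_comp (colspan X)) ** W **
     projection_matrix (orthogonal_comp (colspan X))) *v y)) / real CARD('n)"
  by (simp add: omega_W_def projection_matrix_residual residual_inner_swap flip: matrix_vector_mul_assoc)

lemma omega_W_affine: "omega_W W X (\<delta> *\<^sub>R y + X *v \<eta>) = \<delta>\<^sup>2 * omega_W W X y"
  by (simp add: omega_W_def residual_affine matrix_vector_mult_scaleR power2_eq_square)

lemma continuous_ols: "continuous_on S (ols X)"
  unfolding ols_matrix[abs_def] by (rule matrix_vector_mult_linear_continuous_on)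

lemma continuous_omega_W: "continuous_on S (omega_W W X)"
  unfolding omega_W_quadratic[abs_def]
  by (intro continuous_intros matrix_vector_mult_linear_continuous_on) auto

text \<open>Full row rank makes the transpose of \<open>R\<close> injective, and the inverse Gram
  matrix is positive definite.\<close>

lemma restricted_inverse_gram_pos_def:
  fixes R :: "real^('k::{finite,linorder})^'q"
  assumes "rank R = CARD('q)" "x \<noteq> 0"
  shows "0 < x \<bullet> ((R ** matrix_inv (transpose X ** X) ** transpose R) *v x)"
proof -
  obtain y where "R *v y = x"
    using assms(1) full_rank_surjective[of R] by (metis surjD)
  then have "transpose R *v x \<noteq> 0"
    using assms(2) inner_matrix_transpose[of x R y] by auto
  then have "0 < (transpose R *v x) \<bullet> (matrix_inv (transpose X ** X) *v (transpose R *v x))"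
    using pos_def_matrix_inv gram_pos_def by blast
  then show ?thesis
    by (simp add: inner_matrix_transpose flip: matrix_vector_mul_assoc)
qed

end

theorem corollary5p4:
  fixes X :: "real^('k::{finite,linorder})^('n::{finite,linorder})"
    and R :: "real^('k::{finite,linorder})^'q"
    and r :: "real^'q"
    and W :: "real^('n::{finite,linorder})^('n::{finite,linorder})"
    and F :: "(real \<Rightarrow> real) set"
    and kF :: nat
  assumes "CARD('k) < CARD('n)"
    and "rank X = CARD('k)"
    and "rank R = CARD('q)"
    and "F \<subseteq> F_all"
    and "F_AR2 \<subseteq> F"
    and "polynomial_trend kF X R"
    and "symmetric_matrix W"
    and "projection_matrix (orthogonal_comp (colspan X)) ** W **
           projection_matrix (orthogonal_comp (colspan X)) \<noteq> 0"
    and "nonneg_definite (projection_matrix (orthogonal_comp (colspan X)) ** W **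
           projection_matrix (orthogonal_comp (colspan X)))"
  shows "estimator_conditions X (ols X) (Omega_W W X R) {} \<and>
    (\<forall>C. \<forall>\<mu>0 \<in> null_hypothesis X R r. \<forall>s2 > 0.
       (SUP f\<in>F. measure (gaussian \<mu>0 (s2 *\<^sub>R Sigma_f f))
          {y. F_type_statistic R r (ols X) (Omega_W W X R) {} y \<ge> C}) = 1)"
proof -

  \<comment> \<open>The variance estimator and the estimator conditions\<close>
  note rank_X = assms(2)
  define A where "A = R ** matrix_inv (transpose X ** X) ** transpose R"
  define Q where "Q = projection_matrix (orthogonal_comp (colspan X))"
  define S where "S = Q ** W ** Q"
  have S: "S \<noteq> 0" "nonneg_definite S" using assms by (simp_all add: S_def Q_def)
  have Q: "Q *v y = residual X y" for y
    unfolding Q_def by (rule projection_matrix_residual[OF rank_X])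
  have \<omega>_S: "omega_W W X y = (y \<bullet> (S *v y)) / real CARD('n)" for y
    unfolding S_def Q_def by (rule omega_W_quadratic[OF rank_X])
  have \<omega>_nonneg: "0 \<le> omega_W W X y" for y
    using S(2) by (simp add: \<omega>_S nonneg_definite_def)
  \<comment> \<open>A semidefinite form vanishes only on the kernel, so singularity of the
    covariance estimator is confined to a Lebesgue null set.\<close>
  have \<omega>_zero: "S *v y = 0" if "omega_W W X y = 0" for y
    using that nonneg_definite_ker[OF S(2)] by (simp add: \<omega>_S)
  have A_pd: "0 < x \<bullet> (A *v x)" if "x \<noteq> 0" for x
    unfolding A_def using restricted_inverse_gram_pos_def[OF rank_X assms(3) that] .
  then have A_inv: "invertible A" by (rule pos_def_invertible)
  have \<Omega>: "Omega_W W X R y = omega_W W X y *\<^sub>R A" for y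
    by (simp add: Omega_W_def A_def)
  have \<Omega>_inv: "invertible (Omega_W W X R y) \<longleftrightarrow> omega_W W X y \<noteq> 0" for y
    using scaleR_matrix_inv(1)[OF A_inv, of "omega_W W X y"] det_0
    by (cases "omega_W W X y = 0") (simp_all add: \<Omega> invertible_det_nz)
  have "symmetric_matrix A"
    using symmetric_matrix_inv[OF symmetric_gram[OF rank_X] gram_invertible[OF rank_X]]
    by (simp add: symmetric_matrix_def A_def matrix_transpose_mul transpose_transpose matrix_mul_assoc)
  then have conds: "estimator_conditions X (ols X) (Omega_W W X R) {}"
    unfolding estimator_conditions_def
  proof (intro conjI allI impI)
    show "continuous_on (- {}) (ols X)" by (rule continuous_ols[OF rank_X])
    show "continuous_on (- {}) (Omega_W W X R)"
      unfolding \<Omega>[abs_def] by (intro continuous_intros continuous_omega_W[OF rank_X])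
    show "symmetric_matrix (Omega_W W X R y)" if "symmetric_matrix A" for y
      using that by (simp add: \<Omega> symmetric_matrix_def transpose_scalar)
    show "AE y in lborel. y \<notin> {} \<longrightarrow> invertible (Omega_W W X R y)"
      using AE_matrix_vector_nonzero[OF S(1)] by eventually_elim (use \<omega>_zero \<Omega>_inv in blast)
  qed (simp_all add: ols_affine[OF rank_X] omega_W_affine[OF rank_X] \<Omega>)

  \<comment> \<open>The statistic as a quotient of quadratic forms\<close>
  define T where "T = F_type_statistic R r (ols X) (Omega_W W X R) {}"
  \<comment> \<open>The formula holds everywhere: where \<open>omega_W\<close> vanishes, division by
    zero yields the default value 0 of the statistic.\<close>
  have T: "T y = ((R *v ols X y - r) \<bullet> (matrix_inv A *v (R *v ols X y - r))) / omega_W W X y" for y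
  proof (cases "omega_W W X y = 0")
    case True
    then show ?thesis
      using \<Omega>_inv[of y] by (simp add: T_def F_type_statistic_def invertible_det_nz)
  next
    case False
    then show ?thesis
      using \<Omega>_inv[of y] scaleR_matrix_inv(2)[OF A_inv False]
      by (simp add: T_def F_type_statistic_def invertible_det_nz \<Omega> flip: scaleR_matrix_vector_assoc)
  qed
  have T_meas: "T \<in> borel_measurable borel"
  proof -
    have lin: "continuous_on UNIV (\<lambda>y. M *v g y)" if "continuous_on UNIV g"
      for M :: "real^'a^'b" and g :: "real^('n::{finite,linorder}) \<Rightarrow> real^'a"
      by (rule continuous_on_compose2[OF matrix_vector_mult_linear_continuous_on that]) auto
    show ?thesis
      unfolding T[abs_def]
      by (intro borel_measurable_divide borel_measurable_continuous_onI continuous_omega_W[OF rank_X]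
        continuous_intros lin continuous_ols[OF rank_X])
  qed
  define H where "H = R ** matrix_inv (transpose X ** X) ** transpose X"
  have H: "H *v y = R *v ols X y" for y
    by (simp add: H_def ols_def flip: matrix_vector_mul_assoc)

  \<comment> \<open>Polynomial trends and moments\<close>
  have trend: "1 \<le> kF" "kF \<le> CARD('k)"
    and X_trend: "\<And>t j. pos j \<le> kF \<Longrightarrow> X $ t $ j = real (pos t) ^ (pos j - 1)"
    and "\<exists>i. pos i \<le> kF \<and> column i R \<noteq> 0"
    using assms(6) by (auto simp: polynomial_trend_def)
  then obtain a i0 where "pos i0 \<le> kF \<and> R $ a $ i0 \<noteq> 0"
    by (auto simp: column_def vec_eq_iff)
  \<comment> \<open>In a row of \<open>R\<close> with a nonzero entry among the trend columns, the
    first such entry is selected; its degree \<open>d = pos i - 1\<close> is then the first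
    nonvanishing moment of row \<open>a\<close> of \<open>H\<close>.\<close>
  then obtain i where i: "pos i \<le> kF" "R $ a $ i \<noteq> 0"
    and i_min: "\<And>j. pos j \<le> kF \<Longrightarrow> R $ a $ j \<noteq> 0 \<Longrightarrow> pos i \<le> pos j"
    using ex_has_least_nat[of "\<lambda>i. pos i \<le> kF \<and> R $ a $ i \<noteq> 0" i0 pos] by blast
  define d where "d = pos i - 1"
  have "pos i \<in> {1..CARD('k)}" using pos_range by blast
  then have "1 \<le> pos i" by simp
  have "d < kF" using i \<open>1 \<le> pos i\<close> by (simp add: d_def)
  \<comment> \<open>Column \<open>j\<close> of \<open>X\<close> is the trend of degree
    \<open>pos j - 1\<close>, so moments of the rows of \<open>M\<close> are entries of
    \<open>M X\<close>. For \<open>Q\<close> this product is zero, for \<open>H\<close> it is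
    \<open>R\<close>.\<close>
  have moment_eq: "moment (M $ b) k = (M *v (X *v axis j 1)) $ b"
    if "pos j = k + 1" "k < kF" for M :: "real^('n::{finite,linorder})^'m" and b k j
    using that X_trend[of j] unfolding matrix_vector_axis
    by (simp add: moment_def column_def matrix_vector_mult_def)
  have ex_pos: "\<exists>j :: 'k. pos j = k + 1" if "k < kF" for k
  proof -
    have "k + 1 \<in> range (pos :: 'k \<Rightarrow> nat)"
      unfolding pos_range using that trend by auto
    then show ?thesis by auto
  qed
  have moment_Q: "moment (Q $ b) k = 0" if k: "k < kF" for b k
  proof -
    obtain j :: 'k where "pos j = k + 1" using ex_pos[OF k] by blast
    then show ?thesis
      using k residual_affine[OF rank_X, of 0 0 "axis j 1"] by (simp add: moment_eq Q)
  qed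
  have moment_H: "moment (H $ a) k = R $ a $ j" if "pos j = k + 1" "k < kF" for k j
    using that by (simp add: moment_eq H ols_range[OF rank_X]) (simp add: matrix_vector_axis column_def)
  have moment_H0: "moment (H $ a) k = 0" if "k < d" for k
  proof -
    have "k < kF" using that \<open>d < kF\<close> by simp
    then obtain j :: 'k where j: "pos j = k + 1" using ex_pos by blast
    have "R $ a $ j = 0"
      using i_min[of j] j \<open>k < kF\<close> that unfolding d_def by linarith
    then show ?thesis using moment_H[OF j \<open>k < kF\<close>] by simp
  qed
  have moment_Hd: "moment (H $ a) d \<noteq> 0"
    using moment_H[of i d] i \<open>d < kF\<close> \<open>1 \<le> pos i\<close> by (simp add: d_def)
  then have Ha: "H $ a \<noteq> 0" by (auto simp: moment_def)
  obtain f where f: "\<And>m :: nat. f m \<in> F_AR2" "\<And>m \<omega>. \<omega> \<in> {-pi..pi} \<Longrightarrow> 0 < f m \<omega>"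
    and ratio: "(\<lambda>m. (\<Sum>j\<in>UNIV. Q $ j \<bullet> (Sigma_f (f m) *v Q $ j)) / (\<Sum>a\<in>UNIV. H $ a \<bullet> (Sigma_f (f m) *v H $ a))) \<longlonglongrightarrow> 0"
    by (rule F_AR2_sequence[of kF Q d H a, OF moment_Q moment_H0 moment_Hd \<open>d < kF\<close>]; (assumption | rule that))
  have f_cont: "continuous_on {-pi..pi} (f m)" and f_even: "\<forall>\<omega>\<in>{-pi..pi}. f m (- \<omega>) = f m \<omega>" for m
    using f(1)[of m] by (auto simp: F_AR2_def F_all_def)
  have Sigma_pd: "0 < v \<bullet> (Sigma_f (f m) *v v)" if "v \<noteq> 0" for v :: "real^('n::{finite,linorder})" and m
    using Sigma_f_pos_def[OF f_cont f_even f(2) that] by blast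
  have Sigma_nonneg: "0 \<le> v \<bullet> (Sigma_f (f m) *v v)" for v :: "real^('n::{finite,linorder})" and m
    using Sigma_pd[of v m] by (cases "v = 0") auto

  \<comment> \<open>Rejection probabilities along the sequence of densities\<close>
  have limit: "(SUP f\<in>F. measure (gaussian \<mu>0 (s2 *\<^sub>R Sigma_f f)) {y. T y \<ge> C}) = 1"
    if \<mu>0: "\<mu>0 \<in> null_hypothesis X R r" and "0 < s2" for C \<mu>0 s2
  proof -
    obtain \<beta>0 where \<beta>0: "\<mu>0 = X *v \<beta>0" "R *v \<beta>0 = r"
      using \<mu>0 by (auto simp: null_hypothesis_def)
    \<comment> \<open>The very choice made inside \<open>gaussian\<close>, so that the measure
      unfolds to the law of \<open>\<mu>0 + B m z\<close>.\<close>
    define B where "B m = (SOME B' :: real^('n::{finite,linorder})^('n::{finite,linorder}). B' ** transpose B' = s2 *\<^sub>R Sigma_f (f m))" for m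
    have BB: "B m ** transpose (B m) = s2 *\<^sub>R Sigma_f (f m)" for m
    proof -
      have "nonneg_definite (s2 *\<^sub>R Sigma_f (f m) :: real^('n::{finite,linorder})^('n::{finite,linorder}))"
        using symmetric_Sigma_f[OF f_cont f_even, of m] Sigma_nonneg \<open>0 < s2\<close>
        by (simp add: nonneg_definite_def symmetric_matrix_def transpose_scalar flip: scaleR_matrix_vector_assoc)
      then show ?thesis
        unfolding B_def by (rule someI_ex[OF nonneg_definite_factor])
    qed
    have norm_B: "(norm (M ** B m))\<^sup>2 = s2 * (\<Sum>j\<in>UNIV. M $ j \<bullet> (Sigma_f (f m) *v M $ j))" for M :: "real^('n::{finite,linorder})^'m" and m
      unfolding norm_matrix_mult_factor BB by (simp add: sum_distrib_left flip: scaleR_matrix_vector_assoc)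
    have H_pos: "0 < (\<Sum>j\<in>UNIV. H $ j \<bullet> (Sigma_f (f m) *v H $ j))" for m
      by (rule sum_pos2[of _ a]) (use Sigma_pd[OF Ha] Sigma_nonneg in auto)
    have HB: "H ** B m \<noteq> 0" for m
    proof
      assume "H ** B m = 0"
      then have "s2 * (\<Sum>j\<in>UNIV. H $ j \<bullet> (Sigma_f (f m) *v H $ j)) = 0"
        using norm_B[of H m] by simp
      then show False using H_pos[of m] \<open>0 < s2\<close> by simp
    qed
    \<comment> \<open>The variance factor \<open>s2\<close> cancels in the ratio.\<close>
    have "norm (Q ** B m) / norm (H ** B m) =
        sqrt ((\<Sum>j\<in>UNIV. Q $ j \<bullet> (Sigma_f (f m) *v Q $ j)) / (\<Sum>j\<in>UNIV. H $ j \<bullet> (Sigma_f (f m) *v H $ j)))" for m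
    proof (rule real_sqrt_unique[symmetric])
      show "(norm (Q ** B m) / norm (H ** B m))\<^sup>2 =
        (\<Sum>j\<in>UNIV. Q $ j \<bullet> (Sigma_f (f m) *v Q $ j)) / (\<Sum>j\<in>UNIV. H $ j \<bullet> (Sigma_f (f m) *v H $ j))"
        unfolding power_divide norm_B using \<open>0 < s2\<close> by simp
    qed simp
    then have "(\<lambda>m. norm (Q ** B m) / norm (H ** B m)) \<longlonglongrightarrow> 0"
      using tendsto_real_sqrt[OF ratio] by simp
    then obtain k :: "nat \<Rightarrow> nat" where "strict_mono k"
      and dominates: "AE z in lborel. \<forall>C. \<forall>\<^sub>F i in sequentially.
        C * ((Q ** B (k i) *v z) \<bullet> (W *v (Q ** B (k i) *v z)))
          < (H ** B (k i) *v z) \<bullet> (matrix_inv A *v (H ** B (k i) *v z))"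
      using subsequence_quadratic_dominates[of H B Q "matrix_inv A" W]
        HB pos_def_matrix_inv[OF A_pd] by blast
    define D where "D i = {z. C \<le> T (\<mu>0 + B (k i) *v z)}" for i
    have \<omega>_B: "omega_W W X (\<mu>0 + u) = (Q *v u) \<bullet> (W *v (Q *v u)) / real CARD('n)" for u
      using omega_W_affine[OF rank_X, of W 1 u \<beta>0] by (simp add: \<beta>0 add.commute Q omega_W_def)
    have ols_B: "R *v ols X (\<mu>0 + u) - r = H *v u" for u
      using ols_affine[OF rank_X, of 1 u \<beta>0] by (simp add: \<beta>0 add.commute H matrix_vector_right_distrib)
    \<comment> \<open>A countable union of null sets: the denominator of the statistic is nonzero
      for all indices at once. This secures strict positivity, which the domination alone does not
      give.\<close>
    have "AE z in lborel. \<forall>i. (S ** B (k i)) *v z \<noteq> 0"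
    proof (subst AE_all_countable, intro allI)
      fix i
      have "invertible (s2 *\<^sub>R Sigma_f (f (k i)) :: real^('n::{finite,linorder})^('n::{finite,linorder}))"
        using Sigma_pd \<open>0 < s2\<close> by (intro pos_def_invertible) (simp flip: scaleR_matrix_vector_assoc)
      then have "S ** B (k i) \<noteq> 0"
        using matrix_mult_invertible_right_nonzero[OF S(1)] BB by metis
      then show "AE z in lborel. (S ** B (k i)) *v z \<noteq> 0"
        by (rule AE_matrix_vector_nonzero)
    qed
    with dominates have "AE z in lborel. \<forall>\<^sub>F i in sequentially. z \<in> D i"
    proof eventually_elim
      case (elim z)
      \<comment> \<open>The factor 1/n of \<open>omega_W\<close> is absorbed into the arbitrary
        constant.\<close>
      have "\<forall>\<^sub>F i in sequentially. C / real CARD('n) * ((Q ** B (k i) *v z) \<bullet> (W *v (Q ** B (k i) *v z)))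
          < (H ** B (k i) *v z) \<bullet> (matrix_inv A *v (H ** B (k i) *v z))"
        using elim(1) by blast
      then show ?case
      proof eventually_elim
        case (elim i)
        let ?u = "B (k i) *v z"
        \<comment> \<open>The mean lies in the range of \<open>X\<close>, so the residual does not
          see it.\<close>
        have "omega_W W X (\<mu>0 + ?u) = omega_W W X ?u"
          by (simp add: \<omega>_B) (simp add: omega_W_def Q)
        moreover have "omega_W W X ?u \<noteq> 0"
          using \<omega>_zero[of ?u] \<open>\<forall>i. (S ** B (k i)) *v z \<noteq> 0\<close> by (auto simp: matrix_vector_mul_assoc)
        ultimately have "0 < omega_W W X (\<mu>0 + ?u)"
          using \<omega>_nonneg[of "\<mu>0 + ?u"] by linarith
        moreover have "C * omega_W W X (\<mu>0 + ?u) < (H *v ?u) \<bullet> (matrix_inv A *v (H *v ?u))"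
          using elim by (simp add: \<omega>_B matrix_vector_mul_assoc)
        ultimately show ?case
          by (simp add: D_def T ols_B pos_le_divide_eq)
      qed
    qed
    then have AE_D: "AE z in std_gaussian. \<forall>\<^sub>F i in sequentially. z \<in> D i"
      by (rule AE_std_gaussian)
    have TC: "{y. C \<le> T y} \<in> sets borel"
      using T_meas by measurable
    have D_vimage: "D i = (\<lambda>z. \<mu>0 + B (k i) *v z) -` {y. C \<le> T y} \<inter> space std_gaussian" for i
      by (auto simp: D_def)
    have D_sets: "D i \<in> sets std_gaussian" for i
      unfolding D_vimage by (rule measurable_sets[OF _ TC]) simp
    have meas_D: "measure (gaussian \<mu>0 (s2 *\<^sub>R Sigma_f (f (k i)))) {y. C \<le> T y} = measure std_gaussian (D i)" for i
      unfolding gaussian_def B_def[symmetric] D_vimage by (rule measure_distr[OF _ TC]) simp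
    have lim: "(\<lambda>i. measure (gaussian \<mu>0 (s2 *\<^sub>R Sigma_f (f (k i)))) {y. C \<le> T y}) \<longlonglongrightarrow> 1"
      unfolding meas_D by (rule measure_tendsto_1[OF prob_space_std_gaussian D_sets AE_D])
    have le1: "measure (gaussian \<mu>0 (s2 *\<^sub>R Sigma_f g)) {y. C \<le> T y} \<le> 1" for g
      by (rule prob_space.prob_le_1[OF prob_space_gaussian])
    have fF: "f m \<in> F" for m using f(1) assms(5) by blast
    show ?thesis
    proof (rule antisym)
      show "(SUP f\<in>F. measure (gaussian \<mu>0 (s2 *\<^sub>R Sigma_f f)) {y. T y \<ge> C}) \<le> 1"
        using fF le1 by (intro cSUP_least) auto
      \<comment> \<open>The probabilities along the sequence belong to the family and tend to 1;
        boundedness is required for the real supremum to dominate them.\<close>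
      have "bdd_above ((\<lambda>f. measure (gaussian \<mu>0 (s2 *\<^sub>R Sigma_f f)) {y. C \<le> T y}) ` F)"
        using le1 by (auto intro!: bdd_aboveI[of _ 1])
      then show "1 \<le> (SUP f\<in>F. measure (gaussian \<mu>0 (s2 *\<^sub>R Sigma_f f)) {y. T y \<ge> C})"
        using fF by (intro LIMSEQ_le_const2[OF lim]) (auto intro!: cSUP_upper)
    qed
  qed
  show ?thesis
    using conds limit unfolding T_def by blast
qed

end
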